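(* Suppose $\kappa$ is a singular cardinal and $\vec f=\langle f_\alpha:\alpha<\kappa^+\rangle$ is a scale for $\kappa$. Then there is a club $C\subseteq\kappa^+$ such that for all regular cardinals $\mu,\nu$ with $\operatorname{cf}(\kappa)<\mu<\mu^{+3}\le\nu<\mu^{+\operatorname{cf}(\kappa)}\le\kappa$, $\vec f$ is good at every $\alpha\in C$ of cofinality $\nu$.
   Context: A scale for a singular cardinal $\kappa$ is a sequence $\langle f_\alpha:\alpha<\kappa^+\rangle$ of functions in some product $\prod_{i<\operatorname{cf}(\kappa)}\kappa_i$, with $\langle\kappa_i:i<\operatorname{cf}(\kappa)\rangle$ an increasing sequence of regular cardinals cofinal in $\kappa$, which is increasing and cofinal in the product under the ordering $f<g$ iff $|\{i:f(i)\ge g(i)\}|<\operatorname{cf}(\kappa)$. The scale is good at $\alpha$ if there are a sequence $\langle g_i:i<\operatorname{cf}(\alpha)\rangle$ of functions in the product and $j_\star<\operatorname{cf}(\kappa)$ such that for every $j\ge j_\star$, $\langle g_i(j):i<\operatorname{cf}(\alpha)\rangle$ is strictly increasing, and $\langle g_i:i<\operatorname{cf}(\alpha)\rangle$ and $\langle f_\beta:\beta<\alpha\rangle$ are cofinal in each other under $<$. *)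

theory Defs
  imports Main "HOL-Library.FuncSet"
begin

unbundle cardinal_syntax

text \<open>
  Ordinals are the elements of an arbitrary type \<^typ>\<open>'a::wellorder\<close>, an ordinal \<open>a\<close> being
  identified with the set \<open>{..<a}\<close> of its predecessors.  The order \<open>osegment a\<close> on this set
  connects ordinals with the library's cardinals (which are well-order relations of minimal
  length): the ordinal \<open>a\<close> is a cardinal, i.e. an initial ordinal, iff \<open>Card_order (osegment a)\<close>.
\<close>

definition osegment :: "'a::wellorder \<Rightarrow> 'a rel" where
  "osegment a = relation_of (\<le>) {..<a}"

definition infinite_cardinal :: "'a::wellorder \<Rightarrow> bool" where
  "infinite_cardinal a \<longleftrightarrow> Card_order (osegment a) \<and> cinfinite (osegment a)"

definition regular_cardinal :: "'a::wellorder \<Rightarrow> bool" where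
  "regular_cardinal a \<longleftrightarrow> infinite_cardinal a \<and> regularCard (osegment a)"

definition singular_cardinal :: "'a::wellorder \<Rightarrow> bool" where
  "singular_cardinal a \<longleftrightarrow> infinite_cardinal a \<and> \<not> regularCard (osegment a)"

text \<open>\<open>b = a\<^sup>+\<close>.  The right-hand side implies that \<open>b\<close> is an initial ordinal.\<close>

definition is_card_succ :: "'a::wellorder \<Rightarrow> 'a \<Rightarrow> bool" where
  "is_card_succ a b \<longleftrightarrow> osegment b =o cardSuc (osegment a)"

text \<open>
  \<open>c = \<mu>\<^bsup>+\<xi>\<^esup>\<close>: here \<open>e \<zeta> = \<mu>\<^bsup>+\<zeta>\<^esup>\<close> for \<open>\<zeta> \<le> \<xi>\<close>, by the usual recursion with
  \<open>\<mu>\<^bsup>+0\<^esup> = \<mu>\<close>, \<open>\<mu>\<^bsup>+(\<eta>+1)\<^esup> = (\<mu>\<^bsup>+\<eta>\<^esup>)\<^sup>+\<close> and suprema at limits.  This is a relation rather than a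
  function because the type need not contain a cardinal \<open>\<mu>\<^bsup>+\<xi>\<^esup>\<close>.
\<close>

definition is_card_plus :: "'a::wellorder \<Rightarrow> 'a \<Rightarrow> 'a \<Rightarrow> bool" where
  "is_card_plus \<mu> \<xi> c \<longleftrightarrow>
    (\<exists>e. e \<xi> = c \<and>
      (\<forall>\<zeta>\<le>\<xi>.
        ({..<\<zeta>} = {} \<longrightarrow> e \<zeta> = \<mu>) \<and>
        (\<forall>\<eta>. {..<\<zeta>} = {..\<eta>} \<longrightarrow> is_card_succ (e \<eta>) (e \<zeta>)) \<and>
        ({..<\<zeta>} \<noteq> {} \<and> (\<forall>\<eta>. {..<\<zeta>} \<noteq> {..\<eta>}) \<longrightarrow>
          (\<forall>\<eta><\<zeta>. e \<eta> \<le> e \<zeta>) \<and> (\<forall>x. (\<forall>\<eta><\<zeta>. e \<eta> \<le> x) \<longrightarrow> e \<zeta> \<le> x))))"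

definition cof :: "'a::wellorder \<Rightarrow> 'a" where
  "cof a = (LEAST d. \<exists>h. h ` {..<d} \<subseteq> {..<a} \<and> (\<forall>x<a. \<exists>y<d. x \<le> h y))"

text \<open>
  The library's \<^const>\<open>regularCard\<close> agrees with the definition of regularity and singularity via
  cofinality: \<open>regular_cardinal_iff_cof\<close> and \<open>singular_cardinal_iff_cof\<close> below.
\<close>

lemma Field_osegment: "Field (osegment a) = {..<a}"
  by (auto simp: osegment_def relation_of_def Field_def)

lemma Well_order_osegment: "Well_order (osegment a)"
  unfolding well_order_on_def linear_order_on_def partial_order_on_def preorder_on_def Field_osegment
  apply (intro conjI)
  apply (auto simp: osegment_def relation_of_def refl_on_def trans_def antisym_def total_on_def)
  apply (rule wf_subset[OF wf])
  by auto

lemma Restr_osegment: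
  assumes "d < a"
  shows "Restr (osegment a) (underS (osegment a) d) = osegment d"
  using assms by (auto simp: osegment_def relation_of_def underS_def)

lemma osegment_strict_mono:
  assumes "d < a"
  shows "osegment d <o osegment a"
  using underS_Restr_ordLess[OF Well_order_osegment, of a d] assms
  unfolding Restr_osegment[OF assms] Field_osegment by auto

lemma cof_le: "cof a \<le> (a::'a::wellorder)"
  unfolding cof_def by (rule Least_le) (auto intro!: exI[of _ "\<lambda>x. x"])

lemma cof_witness: "\<exists>h. h ` {..<cof a} \<subseteq> {..<a} \<and> (\<forall>x<a. \<exists>y<cof a. x \<le> h y)"
  unfolding cof_def by (rule LeastI[of _ a]) (auto intro!: exI[of _ "\<lambda>x. x"])

lemma infinite_cardinal_limit: assumes "infinite_cardinal a" "x<a" shows "\<exists>y<a. x<y"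
proof -
  have 1: "Card_order (osegment a)" "\<not> finite (Field (osegment a))" using assms by (auto simp: infinite_cardinal_def cinfinite_def)
  show ?thesis using infinite_Card_order_limit[OF 1, of x] assms(2)
   unfolding Field_osegment by (auto simp: osegment_def relation_of_def)
qed

lemma cof_regular_cardinal: assumes "regular_cardinal a" shows "cof a = a"
proof (rule ccontr)
  assume "cof a \<noteq> a" then have l: "cof a < a" using cof_le[of a] by simp
  have ic: "infinite_cardinal a" and C: "Card_order (osegment a)" and r: "regularCard (osegment a)" using assms by (auto simp: regular_cardinal_def infinite_cardinal_def)
  obtain h where h: "h ` {..<cof a} \<subseteq> {..<a}" "\<forall>x<a. \<exists>y<cof a. x \<le> h y" using cof_witness by blast
  have "cofinal (h ` {..<cof a}) (osegment a)" unfolding cofinal_def Field_osegment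
  proof
    fix x assume "x \<in> {..<a}" 
    then obtain z where "x<z" "z<a" using infinite_cardinal_limit[OF ic] by blast
    then obtain y where "y<cof a" "z \<le> h y" using h by blast
    then show "\<exists>b\<in>h ` {..<cof a}. x \<noteq> b \<and> (x, b) \<in> osegment a"
     using \<open>x<z\<close> h(1) by (intro bexI[of _ "h y"]) (auto simp: osegment_def relation_of_def)
  qed
  then have "|h ` {..<cof a}| =o osegment a" using r h(1) unfolding regularCard_def Field_osegment by blast
  then have "osegment a \<le>o |{..<cof a}|" 
    by (rule ordIso_ordLeq_trans[OF ordIso_symmetric card_of_image])
  moreover have "|{..<cof a}| <o osegment a"
  proof -
    have "|{..<cof a}| \<le>o osegment (cof a)" using card_of_least[of "{..<cof a}" "osegment (cof a)"] Well_order_osegment[of "cof a"] by (simp add: Field_osegment)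
    moreover have "osegment (cof a) <o osegment a" using l by (rule osegment_strict_mono)
    ultimately show ?thesis by (rule ordLeq_ordLess_trans)
  qed
  ultimately show False using not_ordLess_ordLeq by blast
qed

lemma cof_singular_cardinal: assumes s: "singular_cardinal a" shows "cof a < (a::'a::wellorder)"
proof -
  have C: "Card_order (osegment a)" and nr: "\<not> regularCard (osegment a)" using s by (auto simp: singular_cardinal_def infinite_cardinal_def)
  obtain K where K: "K \<subseteq> {..<a}" "cofinal K (osegment a)" "\<not> |K| =o osegment a" using nr unfolding regularCard_def Field_osegment by blast
  have "|K| \<le>o |{..<a}|" using K by (simp add: card_of_mono1)
  then have "|K| \<le>o osegment a" using card_of_Field_ordIso[OF C] unfolding Field_osegment by (rule ordLeq_ordIso_trans)
  then have "|K| <o osegment a" using K(3) ordLeq_iff_ordLess_or_ordIso[of "|K|" "osegment a"] by blast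
  then obtain d where d: "d \<in> Field (osegment a)" "|K| =o Restr (osegment a) (underS (osegment a) d)"
    using ordLess_iff_ordIso_Restr[OF Well_order_osegment[of a] card_of_Well_order[of K]] by blast
  have da: "d<a" using d Field_osegment by auto
  have "osegment d =o |K|"
    using ordIso_symmetric[OF d(2)] unfolding Restr_osegment[OF da] .
  then obtain k where "iso (osegment d) |K| k" unfolding ordIso_def by blast
  then have bij: "bij_betw k {..<d} K" by (simp add: iso_def Field_osegment Field_card_of)
  have "cof a \<le> d" unfolding cof_def
  proof (rule Least_le, intro exI conjI)
    show "k ` {..<d} \<subseteq> {..<a}" using bij K by (auto simp: bij_betw_def)
    show "\<forall>x<a. \<exists>y<d. x \<le> k y"
    proof (intro allI impI)
      fix x assume "x<a"
      then obtain b where "b\<in>K" "x \<le> b" using K(2) unfolding cofinal_def Field_osegment by (force simp: osegment_def relation_of_def)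
      then show "\<exists>y<d. x \<le> k y" using bij by (auto simp: bij_betw_def)
    qed
  qed
  with da show ?thesis by simp
qed

lemma regular_cardinal_iff_cof:
  "regular_cardinal a \<longleftrightarrow> infinite_cardinal a \<and> cof a = a"
proof
  assume "regular_cardinal a"
  then show "infinite_cardinal a \<and> cof a = a"
    using cof_regular_cardinal[of a] by (simp add: regular_cardinal_def)
next
  assume *: "infinite_cardinal a \<and> cof a = a"
  then have "\<not> singular_cardinal a"
    using cof_singular_cardinal[of a] by auto
  with * show "regular_cardinal a"
    by (simp add: regular_cardinal_def singular_cardinal_def)
qed

lemma singular_cardinal_iff_cof:
  "singular_cardinal a \<longleftrightarrow> infinite_cardinal a \<and> cof a < a"
proof
  assume "singular_cardinal a"
  then show "infinite_cardinal a \<and> cof a < a"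
    using cof_singular_cardinal[of a] by (simp add: singular_cardinal_def)
next
  assume *: "infinite_cardinal a \<and> cof a < a"
  then have "\<not> regular_cardinal a"
    using cof_regular_cardinal[of a] by auto
  with * show "singular_cardinal a"
    by (simp add: regular_cardinal_def singular_cardinal_def)
qed

definition club_in :: "'a::wellorder set \<Rightarrow> 'a \<Rightarrow> bool" where
  "club_in C a \<longleftrightarrow> C \<subseteq> {..<a} \<and> (\<forall>x<a. \<exists>c\<in>C. x < c) \<and>
    (\<forall>d<a. {..<d} \<noteq> {} \<and> (\<forall>x<d. \<exists>c\<in>C. x < c \<and> c < d) \<longrightarrow> d \<in> C)"

text \<open>
  Sequences and functions with domain an ordinal \<open>a\<close> are total functions on \<^typ>\<open>'a\<close> of which
  only the values on \<open>{..<a}\<close> matter.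
\<close>

definition scale_product :: "'a::wellorder \<Rightarrow> ('a \<Rightarrow> 'a) \<Rightarrow> ('a \<Rightarrow> 'a) set" where
  "scale_product \<kappa> \<kappa>s = (\<Pi> i\<in>{..<cof \<kappa>}. {..<\<kappa>s i})"

definition scale_less :: "'a::wellorder \<Rightarrow> ('a \<Rightarrow> 'a) \<Rightarrow> ('a \<Rightarrow> 'a) \<Rightarrow> bool" where
  "scale_less \<kappa> f g \<longleftrightarrow> |{i. i < cof \<kappa> \<and> f i \<ge> g i}| <o osegment (cof \<kappa>)"

text \<open>\<open>f\<close> is a scale for \<open>\<kappa>\<close> in the product of the \<open>\<kappa>s i\<close>; \<open>\<kappa>p\<close> stands for \<open>\<kappa>\<^sup>+\<close>.\<close>

definition is_scale ::
    "'a::wellorder \<Rightarrow> 'a \<Rightarrow> ('a \<Rightarrow> 'a) \<Rightarrow> ('a \<Rightarrow> 'a \<Rightarrow> 'a) \<Rightarrow> bool" where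
  "is_scale \<kappa> \<kappa>p \<kappa>s f \<longleftrightarrow>
    (\<forall>i<cof \<kappa>. regular_cardinal (\<kappa>s i) \<and> \<kappa>s i < \<kappa>) \<and>
    strict_mono_on {..<cof \<kappa>} \<kappa>s \<and>
    (\<forall>x<\<kappa>. \<exists>i<cof \<kappa>. x \<le> \<kappa>s i) \<and>
    (\<forall>\<alpha><\<kappa>p. f \<alpha> \<in> scale_product \<kappa> \<kappa>s) \<and>
    (\<forall>\<beta><\<kappa>p. \<forall>\<alpha><\<beta>. scale_less \<kappa> (f \<alpha>) (f \<beta>)) \<and>
    (\<forall>g\<in>scale_product \<kappa> \<kappa>s. \<exists>\<alpha><\<kappa>p. scale_less \<kappa> g (f \<alpha>))"

definition good_at ::
    "'a::wellorder \<Rightarrow> ('a \<Rightarrow> 'a) \<Rightarrow> ('a \<Rightarrow> 'a \<Rightarrow> 'a) \<Rightarrow> 'a \<Rightarrow> bool" where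
  "good_at \<kappa> \<kappa>s f \<alpha> \<longleftrightarrow>
    (\<exists>g. \<exists>j\<^sub>0<cof \<kappa>.
      (\<forall>i<cof \<alpha>. g i \<in> scale_product \<kappa> \<kappa>s) \<and>
      (\<forall>j. j\<^sub>0 \<le> j \<and> j < cof \<kappa> \<longrightarrow> strict_mono_on {..<cof \<alpha>} (\<lambda>i. g i j)) \<and>
      (\<forall>i<cof \<alpha>. \<exists>\<beta><\<alpha>. scale_less \<kappa> (g i) (f \<beta>)) \<and>
      (\<forall>\<beta><\<alpha>. \<exists>i<cof \<alpha>. scale_less \<kappa> (f \<beta>) (g i)))"

end

theory Submission
  imports Defs
begin

text \<open>
  Fix \<open>\<rho>\<close> of cofinality \<open>\<nu>\<close> in the club of ordinals closed under a function that assigns to each \<open>\<delta>\<close> of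
  cofinality below \<open>\<kappa>\<close> an index \<open>d\<close> such that \<open>f d\<close> bounds the pointwise supremum of \<open>f\<close> along a fixed
  club of \<open>\<delta>\<close>.  Following Shelah, club guessing on \<open>\<mu>\<^sup>+\<^sup>+\<close> at cofinality \<open>\<mu>\<close> (this is where
  \<open>\<mu>\<^sup>+\<^sup>+\<^sup>+ \<le> \<nu>\<close> is used) yields the bounding projection property: for sets \<open>S a\<close> of size less than
  \<open>\<mu>\<close>, some \<open>f \<beta>\<close> rounded up into \<open>S\<close> bounds all of \<open>f\<close> below \<open>\<rho>\<close>.  It gives an exact least upper bound
  \<open>g\<close> of \<open>f\<close> below \<open>\<rho>\<close>, with \<open>\<mu> \<le> cof (g a) \<le> \<nu>\<close> for almost all \<open>a\<close>.  By exactness no regular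
  \<open>\<theta> < \<nu>\<close> can equal \<open>cof (g a)\<close> on an unbounded set of \<open>a\<close>; as \<open>\<nu>\<close> is less than the \<open>cof \<kappa>\<close>-th
  successor of \<open>\<mu>\<close>, there are fewer than \<open>cof \<kappa>\<close> such \<open>\<theta>\<close>, so \<open>cof (g a) = \<nu>\<close> for almost all \<open>a\<close>.
  Cofinal \<open>\<nu>\<close>-sequences in the \<open>g a\<close> then witness goodness.
\<close>

subsection \<open>Cofinality and normal sequences\<close>

lemma card_lessThan_less:
  assumes "i < (x::'a::wellorder)"
  shows "|{..<i}| <o osegment x"
proof -
  have "|{..<i}| \<le>o osegment i"
    using card_of_least[of "{..<i}" "osegment i"] Well_order_osegment[of i] by (simp add: Field_osegment)
  then show ?thesis using osegment_strict_mono[OF assms] ordLeq_ordLess_trans by blast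
qed

lemma card_image_lessThan_less:
  assumes "i < (x::'a::wellorder)"
  shows "|h ` {..<i}| <o osegment x"
  using card_of_image[of h "{..<i}"] card_lessThan_less[OF assms] ordLeq_ordLess_trans by blast

lemma osegment_less_iff: "osegment a <o osegment b \<longleftrightarrow> a < (b::'a::wellorder)"
  using osegment_strict_mono[of a b] osegment_strict_mono[of b a] ordLess_irreflexive
    ordLess_transitive[of "osegment a" "osegment b" "osegment a"] by (cases a b rule: linorder_cases) auto

lemma ordLess_osegment_obtain:
  assumes "Well_order r" "r <o osegment (a::'a::wellorder)"
  obtains d where "d < a" "r =o osegment d"
proof -
  obtain d where d: "d \<in> Field (osegment a)" "r =o Restr (osegment a) (underS (osegment a) d)"
    using ordLess_iff_ordIso_Restr[OF Well_order_osegment[of a] assms(1)] assms(2) by blast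
  have "d < a" using d Field_osegment by auto
  then show thesis using that d(2) Restr_osegment by metis
qed

lemma card_ordLess_osegment_obtain:
  assumes "|Y| <o osegment (a::'a::wellorder)"
  obtains d h where "d < a" "bij_betw h {..<d} Y"
proof -
  obtain d where d: "d < a" "|Y| =o osegment d"
    using ordLess_osegment_obtain[OF card_of_Well_order assms] by blast
  have "osegment d =o |Y|" using d(2) ordIso_symmetric by blast
  then obtain k where "iso (osegment d) |Y| k" unfolding ordIso_def by blast
  then have "bij_betw k {..<d} Y" by (simp add: iso_def Field_osegment Field_card_of)
  then show thesis using that d by blast
qed

lemma cof_leI:
  assumes "\<And>y. y < d \<Longrightarrow> h y < a" "\<And>x. x < a \<Longrightarrow> \<exists>y<d. x \<le> h y"
  shows "cof a \<le> (d::'a::wellorder)"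
  unfolding cof_def using assms by (intro Least_le exI[of _ h]) auto

text \<open>An unbounded \<open>Y\<close> of this size, enumerated by some \<open>d < cof x\<close>,
  would be cofinal in \<open>x\<close> and contradict the minimality of
  \<open>cof x\<close>.\<close>

lemma small_bounded:
  fixes x :: "'a::wellorder"
  assumes "|Y| <o osegment (cof x)" "Y \<subseteq> {..<x}"
  shows "\<exists>b<x. \<forall>y\<in>Y. y < b"
proof (rule ccontr)
  assume *: "\<not> ?thesis"
  obtain d h where d: "d < cof x" "bij_betw h {..<d} Y"
    using card_ordLess_osegment_obtain[OF assms(1)] by blast
  have "cof x \<le> d"
  proof (rule cof_leI)
    show "h y < x" if "y < d" for y using d(2) that assms(2) by (auto simp: bij_betw_def)
    show "\<exists>y<d. z \<le> h y" if "z < x" for z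
    proof -
      obtain y where "y \<in> Y" "z \<le> y" using * \<open>z < x\<close> by (meson not_less)
      then show ?thesis using d(2) by (auto simp: bij_betw_def)
    qed
  qed
  with d(1) show False by simp
qed

section \<open>Limit ordinals and normal sequences\<close>

definition is_limit :: "'a::wellorder \<Rightarrow> bool" where
  "is_limit x \<longleftrightarrow> {..<x} \<noteq> {} \<and> (\<forall>y<x. \<exists>z<x. y < z)"

text \<open>Zero and successors have cofinality 0 and 1; \<open>y < d\<close> only says that
  \<open>d\<close> is not zero. Hence an infinite cofinality forces a limit.\<close>

lemma cof_not_limit:
  assumes "\<not> is_limit (x::'a::wellorder)" "y < d"
  shows "cof x \<le> d"
proof (cases "{..<x} = {}")
  case True
  then have "\<And>z. x \<le> z" by (auto simp: set_eq_iff not_less)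
  then show ?thesis using cof_le[of x] order_trans by blast
next
  case False
  then obtain z where "z < x" "\<And>w. w < x \<Longrightarrow> w \<le> z"
    using assms(1) unfolding is_limit_def by (meson not_less)
  then show ?thesis using assms(2) by (intro cof_leI[of d "\<lambda>_. z"]) auto
qed

lemma cof_nonempty: "{..<x} \<noteq> {} \<Longrightarrow> {..<cof x} \<noteq> {}"
  using cof_witness[of x] by fastforce

lemma infinite_cardinal_is_limit: "infinite_cardinal x \<Longrightarrow> is_limit x"
  unfolding is_limit_def using infinite_cardinal_limit[of x]
  by (auto simp: infinite_cardinal_def cinfinite_def Field_osegment)

lemma regular_is_limit: "regular_cardinal x \<Longrightarrow> is_limit x"
  by (simp add: infinite_cardinal_is_limit regular_cardinal_def)

lemma is_limit_of_regular_le_cof: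
  assumes "regular_cardinal \<mu>" "\<mu> \<le> cof (x::'a::wellorder)"
  shows "is_limit x"
proof (rule ccontr)
  assume n: "\<not> is_limit x"
  obtain y z where "y < z" "z < \<mu>" using regular_is_limit[OF assms(1)] unfolding is_limit_def by blast
  then show False using cof_not_limit[OF n \<open>y < z\<close>] assms(2) by auto
qed

lemma regular_small_bounded:
  assumes "regular_cardinal x" "|Y| <o osegment x" "Y \<subseteq> {..<x}"
  shows "\<exists>b<x. \<forall>y\<in>Y. y < b"
  using small_bounded[of Y x] assms cof_regular_cardinal[OF assms(1)] by simp

text \<open>The second clause is continuity, expressed through upper bounds. Its premise holds
  vacuously at the least index, so a nonempty normal sequence starts with the least ordinal.\<close>

definition normal_on :: "'a::wellorder \<Rightarrow> ('a \<Rightarrow> 'a) \<Rightarrow> bool" where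
  "normal_on l \<xi> \<longleftrightarrow> strict_mono_on {..<l} \<xi> \<and>
    (\<forall>i<l. \<forall>r. (\<forall>k<i. \<exists>k'<i. k < k') \<and> (\<forall>k<i. \<xi> k \<le> r) \<longrightarrow> \<xi> i \<le> r)"

text \<open>The \<open>i\<close>-th value is the least bound of all \<open>N \<xi> k\<close> with
  \<open>k < i\<close>. Leastness gives continuity, and \<open>l \<le> cof \<rho>\<close> keeps the
  values below \<open>\<rho>\<close>. By \<open>adm\<close>, \<open>N\<close> consults only values
  already chosen, which makes the recursion legitimate.\<close>

lemma normal_sequence:
  fixes N :: "('a::wellorder \<Rightarrow> 'a) \<Rightarrow> 'a \<Rightarrow> 'a"
  assumes adm: "\<And>\<xi> \<zeta> k. (\<And>j. j \<le> k \<Longrightarrow> \<xi> j = \<zeta> j) \<Longrightarrow> N \<xi> k = N \<zeta> k"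
    and step: "\<And>\<xi> k. k < l \<Longrightarrow> (\<And>j. j \<le> k \<Longrightarrow> \<xi> j < \<rho>) \<Longrightarrow> \<xi> k < N \<xi> k \<and> N \<xi> k < \<rho>"
    and len: "l \<le> cof \<rho>" and ne: "{..<\<rho>} \<noteq> {}"
  obtains \<xi> where "\<And>i. i < l \<Longrightarrow> \<xi> i < \<rho>" "normal_on l \<xi>"
    "\<And>i j. i < j \<Longrightarrow> j < l \<Longrightarrow> N \<xi> i \<le> \<xi> j"
proof -
  have "\<exists>\<xi>. \<forall>i. \<xi> i = (LEAST r. \<forall>k<i. N \<xi> k \<le> r)"
  proof (rule dependent_wellorder_choice)
    fix r and f g :: "'a \<Rightarrow> 'a" and x
    assume *: "\<And>y. y < x \<Longrightarrow> f y = g y"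
    have "N f k = N g k" if "k < x" for k using that * by (intro adm) auto
    then show "(r = (LEAST r. \<forall>k<x. N f k \<le> r)) = (r = (LEAST r. \<forall>k<x. N g k \<le> r))" by simp
  qed auto
  then obtain \<xi> where \<xi>: "\<And>i. \<xi> i = (LEAST r. \<forall>k<i. N \<xi> k \<le> r)" by blast
  have le: "\<xi> i \<le> r" if "\<And>k. k < i \<Longrightarrow> N \<xi> k \<le> r" for i r
    unfolding \<xi>[of i] using that by (intro Least_le) auto
  have lt: "\<xi> i < \<rho> \<and> (\<forall>k<i. N \<xi> k \<le> \<xi> i)" if "i < l" for i
    using that
  proof (induction i rule: less_induct)
    case (less i)
    have "N \<xi> k < \<rho>" if "k < i" for k
      using step[of k \<xi>] less that by force
    then have s: "N \<xi> ` {..<i} \<subseteq> {..<\<rho>}" by auto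
    have "i < cof \<rho>" using less.prems len by simp
    then obtain b where b: "b < \<rho>" "\<forall>y\<in>N \<xi> ` {..<i}. y < b"
      using small_bounded[OF card_image_lessThan_less s] by blast
    have e: "\<forall>k<i. N \<xi> k \<le> b" using b(2) by (auto intro: less_imp_le)
    have "\<xi> i \<le> b" using e le by blast
    moreover have "\<forall>k<i. N \<xi> k \<le> \<xi> i"
      unfolding \<xi>[of i] by (rule LeastI[of _ b]) (rule e)
    ultimately show ?case using b(1) by auto
  qed
  have N: "\<xi> k < N \<xi> k" if "k < l" for k using step[of k \<xi>] lt that by (meson le_less_trans)
  have "strict_mono_on {..<l} \<xi>"
    unfolding strict_mono_on_def using N lt by (metis lessThan_iff less_le_trans)
  \<comment> \<open>At a limit \<open>i\<close> each \<open>N \<xi> k\<close> is at most a later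
    value of \<open>\<xi>\<close>, so a bound of the values of \<open>\<xi>\<close> also bounds
    those of \<open>N\<close>.\<close>
  moreover have "\<xi> i \<le> r" if il: "i < l" and lim: "\<forall>k<i. \<exists>k'<i. k < k'" and ub: "\<forall>k<i. \<xi> k \<le> r" for i r
  proof (rule le)
    fix k assume "k < i"
    then obtain k' where k': "k' < i" "k < k'" using lim by blast
    then have "N \<xi> k \<le> \<xi> k'" using lt[of k'] il by auto
    then show "N \<xi> k \<le> r" using k' ub by (meson order_trans)
  qed
  ultimately have "normal_on l \<xi>" unfolding normal_on_def by blast
  then show thesis using that lt by blast
qed

lemma normal_on_less: "normal_on l \<xi> \<Longrightarrow> i < j \<Longrightarrow> j < l \<Longrightarrow> \<xi> i < \<xi> j"
  unfolding normal_on_def strict_mono_on_def by auto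

lemma normal_on_le:
  assumes "normal_on l \<xi>" "i \<le> j" "j < l"
  shows "\<xi> i \<le> \<xi> j"
  using normal_on_less[OF assms(1), of i j] assms(2,3) order_le_less[of i j] order_le_less[of "\<xi> i"] by blast

lemma normal_on_limit:
  "normal_on l \<xi> \<Longrightarrow> i < l \<Longrightarrow> (\<And>k. k < i \<Longrightarrow> \<exists>k'<i. k < k') \<Longrightarrow> (\<And>k. k < i \<Longrightarrow> \<xi> k \<le> r) \<Longrightarrow> \<xi> i \<le> r"
  unfolding normal_on_def by blast

lemma normal_cofinal_map:
  assumes "is_limit (x::'a::wellorder)"
  obtains e where "\<And>i. i < cof x \<Longrightarrow> e i < x" "normal_on (cof x) e"
    "\<And>y. y < x \<Longrightarrow> \<exists>i<cof x. y < e i"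
proof -
  obtain h where h: "h ` {..<cof x} \<subseteq> {..<x}" "\<forall>y<x. \<exists>i<cof x. y \<le> h i" using cof_witness by blast
  \<comment> \<open>The next value has to pass \<open>h k\<close> as well, so the sequence inherits
    cofinality from \<open>h\<close>.\<close>
  define N where "N = (\<lambda>\<xi> k. LEAST r. \<xi> k < r \<and> h k < (r::'a))"
  have N: "\<xi> k < N \<xi> k \<and> h k < N \<xi> k \<and> N \<xi> k < x" if "k < cof x" "\<xi> k < x" for \<xi> k
  proof -
    have "max (\<xi> k) (h k) < x" using that h by auto
    then obtain z where z: "z < x" "max (\<xi> k) (h k) < z" using assms unfolding is_limit_def by blast
    have "\<xi> k < N \<xi> k \<and> h k < N \<xi> k" unfolding N_def by (rule LeastI[of _ z]) (use z in auto)
    moreover have "N \<xi> k \<le> z" unfolding N_def by (rule Least_le) (use z in auto)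
    ultimately show ?thesis using z by auto
  qed
  have ne: "{..<x} \<noteq> {}" using assms unfolding is_limit_def by auto
  obtain \<xi> where \<xi>: "\<And>i. i < cof x \<Longrightarrow> \<xi> i < x" "normal_on (cof x) \<xi>"
    "\<And>i j. i < j \<Longrightarrow> j < cof x \<Longrightarrow> N \<xi> i \<le> \<xi> j"
  proof (rule normal_sequence[of N "cof x" x])
    show "N \<xi> k = N \<zeta> k" if "\<And>j. j \<le> k \<Longrightarrow> \<xi> j = \<zeta> j" for \<xi> \<zeta> k using that by (simp add: N_def)
    show "\<xi> k < N \<xi> k \<and> N \<xi> k < x" if "k < cof x" "\<And>j. j \<le> k \<Longrightarrow> \<xi> j < x" for \<xi> k
      using N that by blast
  qed (use ne in auto)
  \<comment> \<open>If \<open>i\<close> were the last index, \<open>N \<xi> i < x\<close> would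
    bound all values of \<open>h\<close>.\<close>
  have lim: "\<exists>j<cof x. i < j" if i: "i < cof x" for i
  proof (rule ccontr)
    assume "\<not> ?thesis"
    then have ji: "j \<le> i" if "j < cof x" for j using that not_less by blast
    then have "\<xi> j \<le> \<xi> i" if "j < cof x" for j using that normal_on_less[OF \<xi>(2), of j i] \<open>i < cof x\<close>
      by (metis le_less)
    moreover have "h j < N \<xi> i" if "j < cof x" for j
    proof (cases "j = i")
      case True
      then show ?thesis using N \<xi> \<open>i < cof x\<close> by auto
    next
      case False
      then have "j < i" using ji[OF that] by simp
      then have "N \<xi> j \<le> \<xi> i" using \<xi> \<open>i < cof x\<close> by blast
      then show ?thesis using N[of j \<xi>] N[of i \<xi>] \<xi>(1) \<open>i < cof x\<close> that by (meson le_less_trans less_le_trans less_trans)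
    qed
    moreover have "N \<xi> i < x" using N \<xi>(1) that by blast
    ultimately show False using h(2) by (meson leD)
  qed
  show thesis
  proof (rule that)
    fix y assume "y < x"
    then obtain i where i: "i < cof x" "y \<le> h i" using h(2) by blast
    then obtain j where j: "j < cof x" "i < j" using lim by blast
    have "h i < N \<xi> i" using N \<xi> i by blast
    also have "\<dots> \<le> \<xi> j" using \<xi> j by blast
    finally show "\<exists>i<cof x. y < \<xi> i" using i j by (metis le_less_trans)
  qed (use \<xi> in auto)
qed

text \<open>A monotone cofinal map into \<open>x\<close>, composed with a cofinal map into
  \<open>cof x\<close>, is again cofinal in \<open>x\<close>.\<close>

lemma cof_cof:
  assumes "is_limit (x::'a::wellorder)"
  shows "cof (cof x) = cof x"
proof (rule antisym[OF cof_le])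
  obtain e where e: "\<And>i. i < cof x \<Longrightarrow> e i < x" "normal_on (cof x) e"
    "\<And>y. y < x \<Longrightarrow> \<exists>i<cof x. y < e i" using normal_cofinal_map[OF assms] by blast
  obtain h where h: "h ` {..<cof (cof x)} \<subseteq> {..<cof x}" "\<forall>y<cof x. \<exists>i<cof (cof x). y \<le> h i"
    using cof_witness by blast
  show "cof x \<le> cof (cof x)"
  proof (rule cof_leI)
    show "e (h y) < x" if "y < cof (cof x)" for y using e h that by blast
    show "\<exists>y<cof (cof x). z \<le> e (h y)" if "z < x" for z
    proof -
      obtain i where i: "i < cof x" "z < e i" using e(3)[OF \<open>z < x\<close>] by blast
      then obtain j where j: "j < cof (cof x)" "i \<le> h j" using h by blast
      have "e i \<le> e (h j)" using j h(1) by (intro normal_on_le[OF e(2)]) auto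
      then show ?thesis using j \<open>z < e i\<close> by (meson less_imp_le order_trans)
    qed
  qed
qed

text \<open>A bijection from some \<open>d < cof x\<close> onto \<open>cof x\<close> would turn a
  cofinal map on \<open>cof x\<close> into one on \<open>d\<close>.\<close>

lemma Card_order_cof: "Card_order (osegment (cof (x::'a::wellorder)))"
proof (rule ccontr)
  assume *: "\<not> ?thesis"
  have "|{..<cof x}| \<le>o osegment (cof x)"
    using card_of_least[of "{..<cof x}" "osegment (cof x)"] Well_order_osegment[of "cof x"] by (simp add: Field_osegment)
  moreover have "\<not> |{..<cof x}| =o osegment (cof x)"
    using * Card_order_ordIso[OF card_of_Card_order] ordIso_symmetric by blast
  ultimately have "|{..<cof x}| <o osegment (cof x)" using ordLeq_iff_ordLess_or_ordIso by blast
  then obtain d h where d: "d < cof x" "bij_betw h {..<d} {..<cof x}"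
    using card_ordLess_osegment_obtain by blast
  obtain g where g: "g ` {..<cof x} \<subseteq> {..<x}" "\<forall>y<x. \<exists>i<cof x. y \<le> g i" using cof_witness by blast
  have "cof x \<le> d"
  proof (rule cof_leI)
    show "g (h y) < x" if "y < d" for y using d(2) that g(1) by (auto simp: bij_betw_def)
    show "\<exists>y<d. z \<le> g (h y)" if zx: "z < x" for z
    proof -
      obtain i where i: "i < cof x" "z \<le> g i" using g zx by blast
      then obtain y where "y < d" "h y = i" using d(2) unfolding bij_betw_def by (metis imageE lessThan_iff)
      then show ?thesis using i by auto
    qed
  qed
  with d(1) show False by simp
qed

lemma is_limit_cof:
  assumes "is_limit (x::'a::wellorder)"
  shows "is_limit (cof x)"
proof -
  obtain e where e: "\<And>i. i < cof x \<Longrightarrow> e i < x" "normal_on (cof x) e"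
    "\<And>y. y < x \<Longrightarrow> \<exists>i<cof x. y < e i" using normal_cofinal_map[OF assms] by blast
  have "\<exists>z<cof x. y < z" if y: "y < cof x" for y
  proof -
    obtain z where "z < cof x" "e y < e z" using e y by blast
    then show ?thesis using normal_on_less[OF e(2) _ y, of z] by (metis linorder_neqE order.asym)
  qed
  moreover have "{..<cof x} \<noteq> {}" using assms cof_nonempty unfolding is_limit_def by blast
  ultimately show ?thesis unfolding is_limit_def by blast
qed

lemma is_limit_infinite:
  assumes "is_limit (x::'a::wellorder)"
  shows "infinite {..<x}"
proof
  assume f: "finite {..<x}"
  have "Max {..<x} < x" using f assms Max_in unfolding is_limit_def by blast
  then obtain z where "z < x" "Max {..<x} < z" using assms unfolding is_limit_def by blast
  then show False using Max_ge[OF f, of z] by auto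
qed

lemma regular_cof:
  assumes "is_limit (x::'a::wellorder)"
  shows "regular_cardinal (cof x)"
  unfolding regular_cardinal_iff_cof infinite_cardinal_def cinfinite_def Field_osegment
  using Card_order_cof[of x, unfolded Field_osegment] cof_cof[OF assms] is_limit_infinite[OF is_limit_cof[OF assms]] by simp

text \<open>If \<open>cof x < l\<close>, the values of a shorter cofinal map are passed by
  \<open>\<xi>\<close> at fewer than \<open>l\<close> indices. By regularity these indices have a
  bound \<open>b < l\<close>, and then \<open>\<xi> b\<close> is above the whole map.\<close>

lemma cof_eqI:
  assumes r: "regular_cardinal l" and sm: "strict_mono_on {..<l} \<xi>"
    and "\<And>i. i < l \<Longrightarrow> \<xi> i < x" "\<And>y. y < x \<Longrightarrow> \<exists>i<l. y < \<xi> i"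
  shows "cof x = (l::'a::wellorder)"
proof (rule antisym)
  show "cof x \<le> l" using assms less_imp_le by (intro cof_leI[of l \<xi>]) blast+
  show "l \<le> cof x"
  proof (rule ccontr)
    assume n: "\<not> l \<le> cof x"
    obtain h where h: "h ` {..<cof x} \<subseteq> {..<x}" "\<forall>y<x. \<exists>i<cof x. y \<le> h i" using cof_witness by blast
    have "\<forall>j\<in>{..<cof x}. \<exists>i<l. h j < \<xi> i" using assms(4) h(1) by blast
    then obtain k where k: "\<And>j. j < cof x \<Longrightarrow> k j < l \<and> h j < \<xi> (k j)" by (metis lessThan_iff)
    have "\<exists>b<l. \<forall>y\<in>k ` {..<cof x}. y < b"
      using k n by (intro regular_small_bounded[OF r card_image_lessThan_less]) auto
    then obtain b where b: "b < l" "\<And>j. j < cof x \<Longrightarrow> k j < b" by auto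
    obtain j where j: "j < cof x" "\<xi> b \<le> h j" using h(2) assms(3) b(1) by blast
    then have "\<xi> b < \<xi> (k j)" using k by force
    moreover have "\<xi> (k j) < \<xi> b" using sm b j k unfolding strict_mono_on_def by auto
    ultimately show False by simp
  qed
qed

text \<open>The supremum stays below \<open>\<rho>\<close> because \<open>l < cof \<rho>\<close>; it
  is not attained because \<open>l\<close> is a limit.\<close>

lemma limit_of_sequence:
  assumes r: "regular_cardinal l" and sm: "strict_mono_on {..<l} \<xi>" and l: "l < cof \<rho>"
    and lt: "\<And>i. i < l \<Longrightarrow> \<xi> i < (\<rho>::'a::wellorder)"
  obtains x where "x < \<rho>" "cof x = l" "\<And>i. i < l \<Longrightarrow> \<xi> i < x" "\<And>y. y < x \<Longrightarrow> \<exists>i<l. y < \<xi> i"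
proof -
  have "\<exists>b<\<rho>. \<forall>y\<in>\<xi> ` {..<l}. y < b" using lt l by (intro small_bounded card_image_lessThan_less) auto
  then obtain b where b: "b < \<rho>" "\<forall>i<l. \<xi> i < b" by auto
  define x where "x = (LEAST x. \<forall>i<l. \<xi> i < x)"
  have 1: "\<forall>i<l. \<xi> i < x" unfolding x_def by (rule LeastI[of _ b]) (use b in auto)
  have "x \<le> b" unfolding x_def by (rule Least_le) (use b in auto)
  then have 2: "x < \<rho>" using b by auto
  have 3: "\<exists>i<l. y < \<xi> i" if yx: "y < x" for y
  proof -
    obtain i where i: "i < l" "y \<le> \<xi> i" using not_less_Least[of y "\<lambda>x. \<forall>i<l. \<xi> i < x"] yx unfolding x_def
      by (auto simp: not_less)
    obtain j where j: "j < l" "i < j" using i regular_is_limit[OF r] unfolding is_limit_def by blast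
    then have "\<xi> i < \<xi> j" using sm i unfolding strict_mono_on_def by auto
    then show ?thesis using i j by (meson le_less_trans)
  qed
  show thesis using that[of x] 1 2 3 cof_eqI[OF r sm, of x] by blast
qed

text \<open>\<open>G x\<close> is an index beyond \<open>x\<close> at which each sequence has passed
  the value of the other at \<open>x\<close>. At a closure point of \<open>G\<close> both values are
  suprema of interleaved sequences, hence equal.\<close>

lemma normal_agree:
  assumes \<xi>: "normal_on l \<xi>" and e: "normal_on l e" and l: "is_limit l"
    and i1: "\<And>x. x < l \<Longrightarrow> \<exists>y<l. \<xi> x < e y" and i2: "\<And>x. x < l \<Longrightarrow> \<exists>y<l. e x < \<xi> y"
  obtains G :: "'a::wellorder \<Rightarrow> 'a" where "\<And>x. x < l \<Longrightarrow> G x < l"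
    "\<And>i. i < l \<Longrightarrow> (\<And>x. x < i \<Longrightarrow> G x < i) \<Longrightarrow> \<xi> i = e i"
proof -
  have "\<exists>y<l. x < y \<and> \<xi> x < e y \<and> e x < \<xi> y" if x: "x < l" for x
  proof -
    obtain y1 y2 y3 where y: "y1 < l" "y2 < l" "y3 < l" "x < y1" "\<xi> x < e y2" "e x < \<xi> y3"
      using x i1[OF x] i2[OF x] l unfolding is_limit_def by blast
    define y where "y = max y1 (max y2 y3)"
    have "e y2 \<le> e y" "\<xi> y3 \<le> \<xi> y"
      using y by (auto simp: y_def le_max_iff_disj intro!: normal_on_le[OF e] normal_on_le[OF \<xi>])
    then show ?thesis using y by (intro exI[of _ y]) (auto simp: y_def less_max_iff_disj)
  qed
  then have "\<forall>x. \<exists>y. x < l \<longrightarrow> y < l \<and> x < y \<and> \<xi> x < e y \<and> e x < \<xi> y" by blast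
  then obtain G where G: "\<And>x. x < l \<Longrightarrow> G x < l \<and> x < G x \<and> \<xi> x < e (G x) \<and> e x < \<xi> (G x)" by metis
  show thesis
  proof (rule that)
    show "G x < l" if "x < l" for x using G that by blast
    fix i assume i: "i < l" "\<And>x. x < i \<Longrightarrow> G x < i"
    have lim: "\<exists>k'<i. k < k'" if "k < i" for k using G[of k] i that by (meson less_trans)
    have ub: "\<xi> k \<le> e i \<and> e k \<le> \<xi> i" if k: "k < i" for k
      using normal_on_less[OF e i(2)[OF k] i(1)] normal_on_less[OF \<xi> i(2)[OF k] i(1)]
        G[OF less_trans[OF k i(1)]] by (meson less_imp_le less_trans)
    then show "\<xi> i = e i"
      using normal_on_limit[OF \<xi> i(1) lim] normal_on_limit[OF e i(1) lim] ub by (blast intro: antisym)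
  qed
qed

section \<open>Small sets and successor cardinals\<close>

lemma small_Un:
  assumes "regular_cardinal \<mu>" "|X| <o osegment \<mu>" "|Y| <o osegment \<mu>"
  shows "|X \<union> Y| <o osegment \<mu>"
  using card_of_Un_ordLess_infinite_Field[of "osegment \<mu>" X Y] assms
  unfolding regular_cardinal_def infinite_cardinal_def cinfinite_def by blast

lemma small_finite:
  assumes "regular_cardinal (\<mu>::'a::wellorder)" "finite X"
  shows "|X| <o osegment \<mu>"
proof -
  have "infinite {..<\<mu>}" using is_limit_infinite[OF regular_is_limit[OF assms(1)]] .
  then show ?thesis
    using finite_ordLess_infinite[OF card_of_Well_order[of X] Well_order_osegment[of \<mu>]] assms(2)
    by (simp add: Field_osegment Field_card_of)
qed

lemma small_subset: "Y \<subseteq> X \<Longrightarrow> |X| <o r \<Longrightarrow> |Y| <o r"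
  using card_of_mono1 ordLeq_ordLess_trans by blast

lemma cof_less_of_small_bound:
  assumes "\<theta> < cof x" "\<And>i. i < \<theta> \<Longrightarrow> h i < (x::'a::wellorder)"
  obtains b where "b < x" "\<And>i. i < \<theta> \<Longrightarrow> h i < b"
proof -
  have "\<exists>b<x. \<forall>y\<in>h ` {..<\<theta>}. y < b"
    using assms by (intro small_bounded card_image_lessThan_less) auto
  then show thesis using that by auto
qed

lemma regular_cardinal_cardSuc:
  assumes "Card_order r" "cinfinite r" "osegment b =o cardSuc r"
  shows "regular_cardinal b"
proof -
  have i: "cardSuc r =o osegment b" using assms(3) ordIso_symmetric by blast
  have c: "Cinfinite (cardSuc r)" using Cinfinite_cardSuc assms by blast
  have "Cinfinite (osegment b)" using Cinfinite_cong[OF i c] .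
  moreover have "regularCard (osegment b)" using regularCard_ordIso[OF i c] regularCard_cardSuc assms by blast
  ultimately show ?thesis unfolding regular_cardinal_def infinite_cardinal_def by blast
qed

section \<open>Counting the cardinals between \<mu> and \<nu>\<close>

lemma osegment_le_iff: "osegment a \<le>o osegment b \<longleftrightarrow> a \<le> (b::'a::wellorder)"
  using not_ordLess_iff_ordLeq[OF Well_order_osegment[of a] Well_order_osegment[of b]] osegment_less_iff[of b a]
  by (simp add: not_less)

lemma Card_order_osegment_iff: "Card_order (osegment (a::'a::wellorder)) \<longleftrightarrow> (\<forall>d<a. |{..<d}| <o |{..<a}| )"
proof
  assume C: "Card_order (osegment a)"
  show "\<forall>d<a. |{..<d}| <o |{..<a}|"
  proof (intro allI impI)
    fix d assume "d < a"
    have "|{..<a}| =o osegment a" using card_of_Field_ordIso[OF C] unfolding Field_osegment .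
    then show "|{..<d}| <o |{..<a}|"
      using card_lessThan_less[OF \<open>d < a\<close>] ordIso_symmetric ordLess_ordIso_trans by blast
  qed
next
  assume *: "\<forall>d<a. |{..<d}| <o |{..<a}|"
  have le: "|{..<a}| \<le>o osegment a"
    using card_of_least[of "{..<a}" "osegment a"] Well_order_osegment[of a] by (simp add: Field_osegment)
  show "Card_order (osegment a)"
  proof (cases "|{..<a}| <o osegment a")
    case True
    then obtain d h where d: "d < a" "bij_betw h {..<d} {..<a}"
      using card_ordLess_osegment_obtain by blast
    then have "|{..<d}| =o |{..<a}|" using card_of_ordIso by blast
    then show ?thesis using * d(1) not_ordLess_ordIso by blast
  next
    case False
    then have "|{..<a}| =o osegment a" using le ordLeq_iff_ordLess_or_ordIso by blast
    then show ?thesis using Card_order_ordIso2 card_of_Card_order by blast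
  qed
qed

text \<open>Any \<open>d < a\<close> lies below some \<open>e \<eta>\<close>, a cardinal that
  already has more elements than \<open>{..<d}\<close>.\<close>

lemma Card_order_Sup:
  assumes "\<And>\<eta>. \<eta> \<in> I \<Longrightarrow> Card_order (osegment (e \<eta> :: 'a::wellorder))" "\<And>\<eta>. \<eta> \<in> I \<Longrightarrow> e \<eta> \<le> a"
    and "\<And>x. (\<And>\<eta>. \<eta> \<in> I \<Longrightarrow> e \<eta> \<le> x) \<Longrightarrow> a \<le> x"
  shows "Card_order (osegment a)"
  unfolding Card_order_osegment_iff
proof (intro allI impI)
  fix d assume "d < a"
  then obtain \<eta> where \<eta>: "\<eta> \<in> I" "d < e \<eta>" using assms(3)[of d] not_less by blast
  then have "|{..<d}| <o |{..<e \<eta>}|" using assms(1) Card_order_osegment_iff by blast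
  moreover have "|{..<e \<eta>}| \<le>o |{..<a}|" using assms(2)[OF \<eta>(1)] by (intro card_of_mono1) auto
  ultimately show "|{..<d}| <o |{..<a}|" using ordLess_ordLeq_trans by blast
qed

text \<open>The enumeration \<open>e\<close> behind \<open>is_card_plus\<close> skips no cardinal
  from \<open>\<mu>\<close> on (\<open>hit\<close>). Its value at the limit \<open>\<chi>\<close> is
  a supremum, so \<open>\<nu>\<close> is already passed at some stage
  \<open>\<zeta> < \<chi>\<close>.\<close>

lemma few_cardinals_between:
  fixes \<mu> \<chi> \<theta> \<nu> :: "'a::wellorder"
  assumes plus: "is_card_plus \<mu> \<chi> \<theta>" and \<mu>: "Card_order (osegment \<mu>)" and \<chi>: "is_limit \<chi>" and "\<nu> < \<theta>"
  shows "|{c. Card_order (osegment c) \<and> \<mu> \<le> c \<and> c < \<nu>}| <o osegment \<chi>"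
proof -
  obtain e where e\<chi>: "e \<chi> = \<theta>" and e: "\<forall>\<zeta>\<le>\<chi>.
        ({..<\<zeta>} = {} \<longrightarrow> e \<zeta> = \<mu>) \<and>
        (\<forall>\<eta>. {..<\<zeta>} = {..\<eta>} \<longrightarrow> is_card_succ (e \<eta>) (e \<zeta>)) \<and>
        ({..<\<zeta>} \<noteq> {} \<and> (\<forall>\<eta>. {..<\<zeta>} \<noteq> {..\<eta>}) \<longrightarrow>
          (\<forall>\<eta><\<zeta>. e \<eta> \<le> e \<zeta>) \<and> (\<forall>x. (\<forall>\<eta><\<zeta>. e \<eta> \<le> x) \<longrightarrow> e \<zeta> \<le> x))"
    using plus unfolding is_card_plus_def by blast
  have e0: "e \<zeta> = \<mu>" if "\<zeta> \<le> \<chi>" "{..<\<zeta>} = {}" for \<zeta> using e that by blast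
  have eS: "osegment (e \<zeta>) =o cardSuc (osegment (e \<eta>))" if "\<zeta> \<le> \<chi>" "{..<\<zeta>} = {..\<eta>}" for \<zeta> \<eta>
    using e that unfolding is_card_succ_def by blast
  have eL: "(\<forall>\<eta><\<zeta>. e \<eta> \<le> e \<zeta>) \<and> (\<forall>x. (\<forall>\<eta><\<zeta>. e \<eta> \<le> x) \<longrightarrow> e \<zeta> \<le> x)"
    if "\<zeta> \<le> \<chi>" "{..<\<zeta>} \<noteq> {}" "\<forall>\<eta>. {..<\<zeta>} \<noteq> {..\<eta>}" for \<zeta> using e that by blast
  have card: "Card_order (osegment (e \<zeta>))" if "\<zeta> \<le> \<chi>" for \<zeta>
    using that
  proof (induction \<zeta> rule: less_induct)
    case (less \<zeta>)
    consider "{..<\<zeta>} = {}" | \<eta> where "{..<\<zeta>} = {..\<eta>}" | "{..<\<zeta>} \<noteq> {}" "\<forall>\<eta>. {..<\<zeta>} \<noteq> {..\<eta>}" by blast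
    then show ?case
    proof cases
      case 1
      then show ?thesis using e0 less.prems \<mu> by simp
    next
      case 2
      then have "\<eta> < \<zeta>" by blast
      then have "Card_order (osegment (e \<eta>))" using less by auto
      then show ?thesis using cardSuc_Card_order eS[OF less.prems 2] Card_order_ordIso by blast
    next
      case 3
      have l: "(\<forall>\<eta><\<zeta>. e \<eta> \<le> e \<zeta>)" "(\<forall>x. (\<forall>\<eta><\<zeta>. e \<eta> \<le> x) \<longrightarrow> e \<zeta> \<le> x)"
        using eL[OF less.prems 3] by blast+
      show ?thesis
      proof (rule Card_order_Sup[of "{..<\<zeta>}" e])
        show "Card_order (osegment (e \<eta>))" if "\<eta> \<in> {..<\<zeta>}" for \<eta> using that less by auto
      qed (use l in auto)
    qed
  qed
  have hit: "\<exists>\<eta>\<le>\<zeta>. e \<eta> = c" if c: "Card_order (osegment c)" "\<mu> \<le> c" and le: "c \<le> e \<zeta>" and \<zeta>: "\<zeta> \<le> \<chi>" for c \<zeta>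
  proof -
    \<comment> \<open>The first stage that reaches \<open>c\<close> does not pass it: it is
      \<open>\<mu>\<close>, or the successor of a cardinal below \<open>c\<close>, or a supremum of
      values below \<open>c\<close>.\<close>
    define \<eta> where "\<eta> = (LEAST \<eta>. c \<le> e \<eta>)"
    have c_le: "c \<le> e \<eta>" unfolding \<eta>_def by (rule LeastI[of _ \<zeta>]) (rule le)
    have "\<eta> \<le> \<zeta>" unfolding \<eta>_def by (rule Least_le) (rule le)
    then have \<eta>\<chi>: "\<eta> \<le> \<chi>" using \<zeta> by simp
    have below: "e \<eta>' < c" if "\<eta>' < \<eta>" for \<eta>' using not_less_Least that unfolding \<eta>_def by (metis not_less)
    consider "{..<\<eta>} = {}" | \<eta>' where "{..<\<eta>} = {..\<eta>'}" | "{..<\<eta>} \<noteq> {}" "\<forall>\<eta>'. {..<\<eta>} \<noteq> {..\<eta>'}" by blast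
    then have "e \<eta> \<le> c"
    proof cases
      case 1
      then show ?thesis using e0 \<eta>\<chi> c by simp
    next
      case 2
      then have l: "\<eta>' < \<eta>" by blast
      have "Card_order (osegment (e \<eta>'))" using card l \<eta>\<chi> by simp
      moreover have "osegment (e \<eta>') <o osegment c" using below[OF l] osegment_strict_mono by blast
      ultimately have "cardSuc (osegment (e \<eta>')) \<le>o osegment c" using cardSuc_least c(1) by blast
      then have "osegment (e \<eta>) \<le>o osegment c" using eS[OF \<eta>\<chi> 2] ordIso_ordLeq_trans by blast
      then show ?thesis using osegment_le_iff by blast
    next
      case 3
      then show ?thesis using eL[OF \<eta>\<chi> 3] below less_imp_le by blast
    qed
    then show ?thesis using c_le \<open>\<eta> \<le> \<zeta>\<close> by (intro exI[of _ \<eta>]) auto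
  qed
  have ne: "{..<\<chi>} \<noteq> {}" and above: "\<And>\<eta>. \<eta> < \<chi> \<Longrightarrow> \<exists>\<eta>'<\<chi>. \<eta> < \<eta>'" using \<chi> unfolding is_limit_def by blast+
  have "\<forall>\<eta>. {..<\<chi>} \<noteq> {..\<eta>}"
  proof (intro allI notI)
    fix \<eta> assume *: "{..<\<chi>} = {..\<eta>}"
    then have "\<eta> < \<chi>" by blast
    then obtain \<eta>' where "\<eta>' < \<chi>" "\<eta> < \<eta>'" using above by blast
    then have "\<eta>' \<in> {..\<eta>}" using * by blast
    then show False using \<open>\<eta> < \<eta>'\<close> by simp
  qed
  then have "\<not> (\<forall>\<eta><\<chi>. e \<eta> \<le> \<nu>)" using eL[of \<chi>] ne e\<chi> assms(4) by (meson leD order_refl)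
  then obtain \<zeta> where \<zeta>: "\<zeta> < \<chi>" "\<nu> < e \<zeta>" using not_less by blast
  \<comment> \<open>\<open>hit\<close> allows \<open>\<zeta>\<close> itself as an index, so a strict
    initial segment containing the indices has to end later.\<close>
  obtain \<zeta>' where \<zeta>': "\<zeta>' < \<chi>" "\<zeta> < \<zeta>'" using above \<zeta>(1) by blast
  have "{c. Card_order (osegment c) \<and> \<mu> \<le> c \<and> c < \<nu>} \<subseteq> e ` {..<\<zeta>'}"
  proof
    fix c assume "c \<in> {c. Card_order (osegment c) \<and> \<mu> \<le> c \<and> c < \<nu>}"
    then have "\<exists>\<eta>\<le>\<zeta>. e \<eta> = c" using \<zeta> by (intro hit) auto
    then show "c \<in> e ` {..<\<zeta>'}" using \<zeta>'(2) by (auto intro: le_less_trans)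
  qed
  then show ?thesis using card_image_lessThan_less[OF \<zeta>'(1)] by (rule small_subset)
qed

subsection \<open>Club guessing\<close>

text \<open>\<open>d\<close> is the supremum of an \<open>l\<close>-sequence in which every term is
  at or above the \<open>H\<close>-values of all earlier ones.\<close>

lemma iterate_sequence:
  assumes l: "regular_cardinal l" "l < cof \<rho>" and H: "\<And>x. x < \<rho> \<Longrightarrow> x < H x \<and> H x < (\<rho>::'a::wellorder)"
  obtains d where "d < \<rho>" "cof d = l" "\<And>y. y < d \<Longrightarrow> \<exists>z<d. y < z \<and> H z < d"
proof -
  have ne: "{..<\<rho>} \<noteq> {}"
    using cof_le[of \<rho>] l(2) by (metis lessThan_iff empty_iff less_le_trans)
  obtain \<xi> where \<xi>: "\<And>i. i < l \<Longrightarrow> \<xi> i < \<rho>" "normal_on l \<xi>"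
    "\<And>i j. i < j \<Longrightarrow> j < l \<Longrightarrow> H (\<xi> i) \<le> \<xi> j"
    using normal_sequence[of "\<lambda>\<xi> k. H (\<xi> k)" l \<rho>] H l(2) ne by (metis less_imp_le order_refl)
  have sm: "strict_mono_on {..<l} \<xi>" using \<xi>(2) unfolding normal_on_def by blast
  obtain d where d: "d < \<rho>" "cof d = l" "\<And>i. i < l \<Longrightarrow> \<xi> i < d" "\<And>y. y < d \<Longrightarrow> \<exists>i<l. y < \<xi> i"
    using limit_of_sequence[OF l(1) sm l(2) \<xi>(1)] by blast
  have "\<exists>z<d. y < z \<and> H z < d" if y: "y < d" for y
  proof -
    obtain i where i: "i < l" "y < \<xi> i" using d(4)[OF y] by blast
    obtain j where j: "i < j" "j < l" using regular_is_limit[OF l(1)] i unfolding is_limit_def by blast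
    have "H (\<xi> i) < d" using \<xi>(3)[OF j] d(3)[OF j(2)] by simp
    then show ?thesis using i d(3) by blast
  qed
  then show thesis using that d by blast
qed

text \<open>Iterate a function \<open>H\<close> that passes \<open>x\<close> and all values of
  \<open>G\<close> up to its argument. Any regular length \<open>\<mu> < \<Lambda>\<close> will
  do.\<close>

lemma closure_points_unbounded:
  assumes L: "regular_cardinal \<Lambda>" and m: "regular_cardinal \<mu>" "\<mu> < \<Lambda>"
    and G: "\<And>x. x < \<Lambda> \<Longrightarrow> G x < (\<Lambda>::'a::wellorder)" and x: "x < \<Lambda>"
  shows "\<exists>d<\<Lambda>. x < d \<and> (\<forall>y<d. G y < d)"
proof -
  have lim: "\<exists>z<\<Lambda>. y < z" if "y < \<Lambda>" for y using regular_is_limit[OF L] that unfolding is_limit_def by blast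
  have "\<exists>b<\<Lambda>. y < b \<and> x < b \<and> (\<forall>z\<le>y. G z < b)" if y: "y < \<Lambda>" for y
  proof -
    obtain z where z: "z < \<Lambda>" "y < z" using lim y by blast
    have "\<exists>b<\<Lambda>. \<forall>w\<in>G ` {..<z}. w < b"
      using G z by (intro regular_small_bounded[OF L card_image_lessThan_less]) (auto intro: less_trans)
    then obtain b where b: "b < \<Lambda>" "\<And>w. w < z \<Longrightarrow> G w < b" by auto
    obtain c where c: "c < \<Lambda>" "max b (max x y) < c" using lim[of "max b (max x y)"] b x y by auto
    have "G w < c" if "w \<le> y" for w using b(2)[OF le_less_trans[OF that z(2)]] c(2) by (auto intro: less_trans)
    then show ?thesis using c by auto
  qed
  then have "\<forall>y. \<exists>b. y < \<Lambda> \<longrightarrow> b < \<Lambda> \<and> y < b \<and> x < b \<and> (\<forall>z\<le>y. G z < b)" by blast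
  then obtain H where H: "\<And>y. y < \<Lambda> \<Longrightarrow> H y < \<Lambda> \<and> y < H y \<and> x < H y \<and> (\<forall>z\<le>y. G z < H y)" by metis
  have "\<mu> < cof \<Lambda>" using cof_regular_cardinal[OF L] m by simp
  then obtain d where d: "d < \<Lambda>" "cof d = \<mu>" "\<And>y. y < d \<Longrightarrow> \<exists>z<d. y < z \<and> H z < d"
    using iterate_sequence[OF m(1), of \<Lambda> H] H by blast
  have "is_limit d" using is_limit_of_regular_le_cof[OF m(1)] d by simp
  then obtain y where "y < d" unfolding is_limit_def by blast
  then have "x < d" using d(3)[of y] H d(1) by (meson less_trans)
  moreover have "G y < d" if "y < d" for y
    using d(3)[OF that] H d(1) by (meson less_imp_le less_trans)
  ultimately show ?thesis using d(1) by blast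
qed

lemma club_in_closure_points:
  assumes "regular_cardinal \<Lambda>" "regular_cardinal \<mu>" "\<mu> < \<Lambda>"
    and "\<And>x. x < \<Lambda> \<Longrightarrow> G x < (\<Lambda>::'a::wellorder)"
  shows "club_in {d. d < \<Lambda> \<and> (\<forall>y<d. G y < d)} \<Lambda>"
  unfolding club_in_def
proof (intro conjI allI impI)
  show "\<exists>c\<in>{d. d < \<Lambda> \<and> (\<forall>y<d. G y < d)}. x < c" if "x < \<Lambda>" for x
    using closure_points_unbounded[OF assms(1-3), of G x] assms(4) that by blast
  fix d
  assume "d < \<Lambda>" and *: "{..<d} \<noteq> {} \<and> (\<forall>x<d. \<exists>c\<in>{d. d < \<Lambda> \<and> (\<forall>y<d. G y < d)}. x < c \<and> c < d)"
  moreover have "G y < d" if y: "y < d" for y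
  proof -
    obtain c where "\<forall>y<c. G y < c" "y < c" "c < d" using * y by blast
    then show ?thesis by (blast intro: less_trans)
  qed
  ultimately show "d \<in> {d. d < \<Lambda> \<and> (\<forall>y<d. G y < d)}" by blast
qed auto

text \<open>A decreasing sequence of ordinals is constant from the index \<open>s a < l\<close>
  where it attains its minimum. Fewer than \<open>l\<close> such indices have a common bound below
  \<open>l\<close>.\<close>

lemma antimono_stabilizes:
  fixes t :: "'i \<Rightarrow> 'a::wellorder \<Rightarrow> 'b::wellorder"
  assumes l: "regular_cardinal l" and A: "|A| <o osegment l"
    and t: "\<And>a \<alpha> \<beta>. a \<in> A \<Longrightarrow> \<alpha> \<le> \<beta> \<Longrightarrow> \<beta> < l \<Longrightarrow> t a \<beta> \<le> t a \<alpha>"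
  obtains \<alpha> \<beta> where "\<alpha> < \<beta>" "\<beta> < l" "\<And>a. a \<in> A \<Longrightarrow> t a \<beta> = t a \<alpha>"
proof -
  have lim: "\<exists>z<l. y < z" if "y < l" for y using regular_is_limit[OF l] that unfolding is_limit_def by blast
  obtain z where z: "z < l" using regular_is_limit[OF l] unfolding is_limit_def by blast
  have "\<exists>\<alpha><l. \<forall>\<beta><l. t a \<alpha> \<le> t a \<beta>" for a
  proof -
    define m where "m = (LEAST v. \<exists>\<alpha><l. v = t a \<alpha>)"
    have "\<exists>\<alpha><l. m = t a \<alpha>" unfolding m_def by (rule LeastI_ex) (use z in blast)
    moreover have "m \<le> t a \<beta>" if "\<beta> < l" for \<beta> unfolding m_def by (rule Least_le) (use that in blast)
    ultimately show ?thesis by blast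
  qed
  then obtain s where s: "\<And>a. s a < l" "\<And>a \<beta>. \<beta> < l \<Longrightarrow> t a (s a) \<le> t a \<beta>" by metis
  have "|s ` A| <o osegment l" using card_of_image A ordLeq_ordLess_trans by blast
  moreover have "s ` A \<subseteq> {..<l}" using s(1) by auto
  ultimately obtain \<alpha> where \<alpha>: "\<alpha> < l" "\<And>a. a \<in> A \<Longrightarrow> s a < \<alpha>"
    using regular_small_bounded[OF l, of "s ` A"] by auto
  obtain \<beta> where \<beta>: "\<beta> < l" "\<alpha> < \<beta>" using lim \<alpha> by blast
  have "t a \<gamma> = t a (s a)" if "a \<in> A" "\<alpha> \<le> \<gamma>" "\<gamma> < l" for a \<gamma>
    using t[of a "s a" \<gamma>] s(2)[of \<gamma> a] \<alpha>(2)[of a] that by (intro antisym) auto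
  then show thesis using that[of \<alpha> \<beta>] \<alpha> \<beta> by simp
qed

text \<open>
  Instead of clubs in \<open>\<Lambda>\<close>, club guessing is stated for the sets of closure points of functions
  \<open>G\<close> on \<open>\<Lambda>\<close>; every club contains such a set.  An intersection of such sets is \<open>seq_closed\<close>, and
  \<open>drop_into E \<gamma>\<close> is the largest element of a \<open>seq_closed\<close> set \<open>E\<close> below \<open>\<gamma>\<close>.
\<close>

definition seq_closed :: "'a::wellorder set \<Rightarrow> bool" where
  "seq_closed E \<longleftrightarrow> (\<forall>d. (\<forall>x<d. \<exists>e\<in>E. x < e \<and> e \<le> d) \<longrightarrow> d \<in> E)"

definition drop_into :: "'a::wellorder set \<Rightarrow> 'a \<Rightarrow> 'a" where
  "drop_into E \<gamma> = (LEAST m. \<forall>d\<in>E. d \<le> \<gamma> \<longrightarrow> d \<le> m)"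

lemma drop_into_le: "drop_into E \<gamma> \<le> \<gamma>"
  unfolding drop_into_def by (rule Least_le) simp

lemma drop_into_upper: "d \<in> E \<Longrightarrow> d \<le> \<gamma> \<Longrightarrow> d \<le> drop_into E \<gamma>"
  unfolding drop_into_def using LeastI[of "\<lambda>m. \<forall>d\<in>E. d \<le> \<gamma> \<longrightarrow> d \<le> m" \<gamma>] by blast

text \<open>By leastness every smaller \<open>x\<close> is passed by an element of \<open>E\<close>
  that is at most \<open>drop_into E \<gamma>\<close>, so closure applies. The least ordinal lies in
  every \<open>seq_closed\<close> set, vacuously, so there is always something to drop to.\<close>

lemma drop_into_in:
  assumes "seq_closed E"
  shows "drop_into E \<gamma> \<in> E"
proof -
  have "\<exists>e\<in>E. x < e \<and> e \<le> drop_into E \<gamma>" if x: "x < drop_into E \<gamma>" for x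
  proof -
    have "\<not> (\<forall>d\<in>E. d \<le> \<gamma> \<longrightarrow> d \<le> x)" using not_less_Least x unfolding drop_into_def by blast
    then obtain d where "d \<in> E" "d \<le> \<gamma>" "x < d" using not_less by blast
    then show ?thesis using drop_into_upper by blast
  qed
  then show ?thesis using assms unfolding seq_closed_def by blast
qed

lemma drop_into_mono:
  assumes "E' \<subseteq> E" shows "drop_into E' \<gamma> \<le> drop_into E \<gamma>"
  unfolding drop_into_def[of E'] using assms drop_into_upper[of _ E \<gamma>] by (intro Least_le) blast

text \<open>
  Start with arbitrary cofinal sets \<open>K \<delta>\<close> of size \<open>\<mu>\<close>.  As long as dropping them into \<open>E\<close> fails to
  guess the closure points of some \<open>G\<close>, shrink \<open>E\<close> to the closure points of \<open>G\<close> in it.  After \<open>\<mu>1\<close>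
  failures pick a limit point \<open>\<delta>\<close> of the intersection: each \<open>\<gamma> \<in> K \<delta>\<close> was dropped lower and lower,
  hence only finitely often, so some stage did not move \<open>K \<delta>\<close> and could not have failed at \<open>\<delta>\<close>.
\<close>

lemma club_guessing:
  fixes \<mu> \<mu>1 \<Lambda> :: "'a::wellorder"
  assumes m: "regular_cardinal \<mu>" and m1: "regular_cardinal \<mu>1" and L: "regular_cardinal \<Lambda>"
    and lt: "\<mu> < \<mu>1" "\<mu>1 < \<Lambda>"
  obtains C :: "'a \<Rightarrow> 'a set" where
    "\<And>G. (\<And>x. x < \<Lambda> \<Longrightarrow> G x < \<Lambda>) \<Longrightarrow> \<exists>\<delta><\<Lambda>. cof \<delta> = \<mu> \<and> C \<delta> \<subseteq> {..<\<delta>} \<and>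
      (\<forall>x<\<delta>. \<exists>y\<in>C \<delta>. x < y) \<and> (\<forall>i\<in>C \<delta>. \<forall>x<i. G x < i)"
proof -
  have "\<exists>K. cof \<delta> = \<mu> \<longrightarrow> |K| <o osegment \<mu>1 \<and> K \<subseteq> {..<\<delta>} \<and> (\<forall>x<\<delta>. \<exists>y\<in>K. x < y)" for \<delta>
  proof (cases "cof \<delta> = \<mu>")
    case True
    have "is_limit \<delta>" using is_limit_of_regular_le_cof[OF m] True by simp
    from normal_cofinal_map[OF this] obtain e where e: "\<And>i. i < cof \<delta> \<Longrightarrow> e i < \<delta>"
      "normal_on (cof \<delta>) e" "\<And>y. y < \<delta> \<Longrightarrow> \<exists>i<cof \<delta>. y < e i" by blast
    show ?thesis
      using e(1,3) True card_image_lessThan_less[OF lt(1), of e] by (intro exI[of _ "e ` {..<\<mu>}"]) auto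
  qed auto
  then obtain K where K: "\<And>\<delta>. cof \<delta> = \<mu> \<Longrightarrow> |K \<delta>| <o osegment \<mu>1"
    "\<And>\<delta>. cof \<delta> = \<mu> \<Longrightarrow> K \<delta> \<subseteq> {..<\<delta>}" "\<And>\<delta> x. cof \<delta> = \<mu> \<Longrightarrow> x < \<delta> \<Longrightarrow> \<exists>y\<in>K \<delta>. x < y" by metis
  define lim where "lim = (\<lambda>E \<delta>. \<forall>x<\<delta>. \<exists>e\<in>E. x < e \<and> e < (\<delta>::'a))"
  \<comment> \<open>\<open>bad E G\<close> means that dropping into \<open>E\<close> guesses the
    closure points of \<open>G\<close> at no limit point of \<open>E\<close> of cofinality
    \<open>\<mu>\<close>.\<close>
  define bad where "bad = (\<lambda>E G. (\<forall>x<\<Lambda>. G x < \<Lambda>) \<and>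
    (\<forall>\<delta><\<Lambda>. cof \<delta> = \<mu> \<and> lim E \<delta> \<longrightarrow> (\<exists>\<gamma>\<in>K \<delta>. \<exists>x<drop_into E \<gamma>. \<not> G x < drop_into E \<gamma>)))"
  have "\<exists>E. seq_closed E \<and> (\<forall>G. \<not> bad E G)"
  proof (rule ccontr)
    assume none: "\<not> ?thesis"
    define E where "E = (\<lambda>(Gs :: 'a \<Rightarrow> 'a \<Rightarrow> 'a) (\<alpha> :: 'a). {d. \<forall>\<beta><\<alpha>. \<forall>x<d. Gs \<beta> x < d})"
    have E_closed: "seq_closed (E Gs \<alpha>)" for Gs \<alpha>
      unfolding seq_closed_def
    proof (intro allI impI)
      fix d assume *: "\<forall>x<d. \<exists>e\<in>E Gs \<alpha>. x < e \<and> e \<le> d"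
      have "Gs \<beta> x < d" if "\<beta> < \<alpha>" "x < d" for \<beta> x
      proof -
        obtain e where "e \<in> E Gs \<alpha>" "x < e" "e \<le> d" using * \<open>x < d\<close> by blast
        then show ?thesis using \<open>\<beta> < \<alpha>\<close> unfolding E_def by (blast intro: less_le_trans)
      qed
      then show "d \<in> E Gs \<alpha>" unfolding E_def by blast
    qed
    have "\<exists>Gs. \<forall>\<alpha>. bad (E Gs \<alpha>) (Gs \<alpha>)"
    proof (rule dependent_wellorder_choice[where P = "\<lambda>Gs \<alpha> r. bad (E Gs \<alpha>) r"])
      fix r and f g :: "'a \<Rightarrow> 'a \<Rightarrow> 'a" and \<alpha>
      assume "\<And>y. y < \<alpha> \<Longrightarrow> f y = g y"
      then have "E f \<alpha> = E g \<alpha>" unfolding E_def by auto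
      then show "bad (E f \<alpha>) r = bad (E g \<alpha>) r" by simp
    qed (use none E_closed in blast)
    then obtain Gs where Gs: "\<And>\<alpha>. bad (E Gs \<alpha>) (Gs \<alpha>)" by blast
    have Gs_lt: "Gs \<alpha> x < \<Lambda>" if "x < \<Lambda>" for \<alpha> x using Gs that unfolding bad_def by blast
    have anti: "E Gs \<beta> \<subseteq> E Gs \<alpha>" if "\<alpha> \<le> \<beta>" for \<alpha> \<beta>
      unfolding E_def using that by (blast intro: less_le_trans)
    \<comment> \<open>As \<open>\<mu>1 < \<Lambda>\<close>, one function \<open>G\<close> dominates
      all \<open>Gs \<beta>\<close> with \<open>\<beta> < \<mu>1\<close>; its closure points lie in
      every stage up to \<open>\<mu>1\<close>.\<close>
    have "\<exists>b<\<Lambda>. \<forall>\<beta><\<mu>1. Gs \<beta> x < b" if "x < \<Lambda>" for x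
      using regular_small_bounded[OF L card_image_lessThan_less[OF lt(2)], of "\<lambda>\<beta>. Gs \<beta> x"] Gs_lt[OF that] by auto
    then obtain G where G: "\<And>x. x < \<Lambda> \<Longrightarrow> G x < \<Lambda>" "\<And>x \<beta>. x < \<Lambda> \<Longrightarrow> \<beta> < \<mu>1 \<Longrightarrow> Gs \<beta> x < G x" by metis
    have "\<exists>d<\<Lambda>. x < d \<and> (\<forall>y<d. G y < d)" if "x < \<Lambda>" for x
      using closure_points_unbounded[OF L m1 lt(2), of G] G(1) that by blast
    then have "\<exists>d<\<Lambda>. x < d \<and> d \<in> E Gs \<mu>1" if "x < \<Lambda>" for x
      using that G(2) unfolding E_def mem_Collect_eq by (meson less_trans)
    then obtain H where H: "\<And>x. x < \<Lambda> \<Longrightarrow> x < H x \<and> H x < \<Lambda>" "\<And>x. x < \<Lambda> \<Longrightarrow> H x \<in> E Gs \<mu>1" by metis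
    have "\<mu> < cof \<Lambda>" using cof_regular_cardinal[OF L] lt by simp
    then obtain \<delta> where \<delta>: "\<delta> < \<Lambda>" "cof \<delta> = \<mu>" "\<And>y. y < \<delta> \<Longrightarrow> \<exists>z<\<delta>. y < z \<and> H z < \<delta>"
      using iterate_sequence[OF m, of \<Lambda> H] H by blast
    have "lim (E Gs \<mu>1) \<delta>" unfolding lim_def using \<delta> H by (meson less_trans)
    then have lim: "lim (E Gs \<alpha>) \<delta>" if "\<alpha> < \<mu>1" for \<alpha>
      unfolding lim_def using anti[OF less_imp_le[OF that]] by blast
    obtain \<alpha> \<beta> where ab: "\<alpha> < \<beta>" "\<beta> < \<mu>1"
      "\<And>\<gamma>. \<gamma> \<in> K \<delta> \<Longrightarrow> drop_into (E Gs \<beta>) \<gamma> = drop_into (E Gs \<alpha>) \<gamma>"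
      using antimono_stabilizes[OF m1 K(1)[OF \<delta>(2)], of "\<lambda>\<gamma> \<alpha>. drop_into (E Gs \<alpha>) \<gamma>"]
        drop_into_mono[OF anti] by blast
    have "lim (E Gs \<alpha>) \<delta>" using lim[OF less_trans[OF ab(1,2)]] .
    then obtain \<gamma> x where gx: "\<gamma> \<in> K \<delta>" "x < drop_into (E Gs \<alpha>) \<gamma>" "\<not> Gs \<alpha> x < drop_into (E Gs \<alpha>) \<gamma>"
      using Gs[of \<alpha>] \<delta>(1,2) unfolding bad_def by blast
    \<comment> \<open>The point was not moved between the two stages, so it lies in the later one,
      whose elements are closed under \<open>Gs \<alpha>\<close>.\<close>
    have "drop_into (E Gs \<alpha>) \<gamma> \<in> E Gs \<beta>"
      using ab(3)[OF gx(1)] drop_into_in[OF E_closed, of Gs \<beta> \<gamma>] by simp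
    then show False using gx ab(1) unfolding E_def by blast
  qed
  then obtain E where E: "seq_closed E" "\<And>G. \<not> bad E G" by blast
  show thesis
  proof (rule that[of "\<lambda>\<delta>. drop_into E ` K \<delta>"])
    fix G assume "\<And>x. x < \<Lambda> \<Longrightarrow> G x < \<Lambda>"
    then obtain \<delta> where \<delta>: "\<delta> < \<Lambda>" "cof \<delta> = \<mu>" "lim E \<delta>"
      "\<And>\<gamma> x. \<gamma> \<in> K \<delta> \<Longrightarrow> x < drop_into E \<gamma> \<Longrightarrow> G x < drop_into E \<gamma>"
      using E(2)[of G] unfolding bad_def by blast
    have "drop_into E \<gamma> < \<delta>" if "\<gamma> \<in> K \<delta>" for \<gamma>
      using K(2)[OF \<delta>(2)] that drop_into_le[of E \<gamma>] by auto
    moreover have "\<exists>\<gamma>\<in>K \<delta>. x < drop_into E \<gamma>" if "x < \<delta>" for x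
    proof -
      \<comment> \<open>An element of \<open>E\<close> below \<open>\<gamma>\<close> stays below or
        at the dropped point, so dropping preserves cofinality at limit points of
        \<open>E\<close>.\<close>
      obtain e where e: "e \<in> E" "x < e" "e < \<delta>" using \<delta>(3) \<open>x < \<delta>\<close> unfolding lim_def by blast
      obtain \<gamma> where "\<gamma> \<in> K \<delta>" "e < \<gamma>" using K(3)[OF \<delta>(2) e(3)] by blast
      then show ?thesis using e drop_into_upper[of e E \<gamma>] by (meson less_imp_le less_le_trans)
    qed
    ultimately show "\<exists>\<delta><\<Lambda>. cof \<delta> = \<mu> \<and> drop_into E ` K \<delta> \<subseteq> {..<\<delta>} \<and>
      (\<forall>x<\<delta>. \<exists>y\<in>drop_into E ` K \<delta>. x < y) \<and> (\<forall>i\<in>drop_into E ` K \<delta>. \<forall>x<i. G x < i)"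
      using \<delta> by (intro exI[of _ \<delta>]) auto
  qed
qed

subsection \<open>The bounding projection property\<close>

text \<open>One choice for all ordinals, so that the bounds fixed in advance and the sequences built
  later refer to the same cofinal sequence. It is meaningful at limits.\<close>

definition cof_seq :: "'a::wellorder \<Rightarrow> 'a \<Rightarrow> 'a" where
  "cof_seq x = (SOME e. (\<forall>i<cof x. e i < x) \<and> normal_on (cof x) e \<and> (\<forall>y<x. \<exists>i<cof x. y < e i))"

lemma cof_seq:
  assumes "is_limit x"
  shows "(\<forall>i<cof x. cof_seq x i < x) \<and> normal_on (cof x) (cof_seq x) \<and> (\<forall>y<x. \<exists>i<cof x. y < cof_seq x i)"
proof -
  from normal_cofinal_map[OF assms] obtain e where "\<And>i. i < cof x \<Longrightarrow> e i < x" "normal_on (cof x) e"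
    "\<And>y. y < x \<Longrightarrow> \<exists>i<cof x. y < e i" by blast
  then have "(\<forall>i<cof x. e i < x) \<and> normal_on (cof x) e \<and> (\<forall>y<x. \<exists>i<cof x. y < e i)" by blast
  then show ?thesis unfolding cof_seq_def by (rule someI[where P = "\<lambda>e. (\<forall>i<cof x. e i < x) \<and> normal_on (cof x) e \<and> (\<forall>y<x. \<exists>i<cof x. y < e i)"])
qed

lemma cof_seq_less: "is_limit x \<Longrightarrow> i < cof x \<Longrightarrow> cof_seq x i < x"
  using cof_seq by blast

lemma cof_seq_normal: "is_limit x \<Longrightarrow> normal_on (cof x) (cof_seq x)"
  using cof_seq by blast

lemma cof_seq_cofinal: "is_limit x \<Longrightarrow> y < x \<Longrightarrow> \<exists>i<cof x. y < cof_seq x i"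
  using cof_seq by blast

text \<open>Projection of \<open>g\<close> to the product of the sets \<open>S a\<close>, meaningful
  where \<open>S a\<close> has an element at or above \<open>g a\<close>.\<close>

definition round_up :: "('i \<Rightarrow> 'a::wellorder set) \<Rightarrow> ('i \<Rightarrow> 'a) \<Rightarrow> 'i \<Rightarrow> 'a" where
  "round_up S g a = (LEAST s. s \<in> S a \<and> g a \<le> s)"

lemma
  assumes "s \<in> S a" "g a \<le> s"
  shows round_up_in: "round_up S g a \<in> S a" and le_round_up: "g a \<le> round_up S g a" and round_up_le: "round_up S g a \<le> s"
  using LeastI[of "\<lambda>s. s \<in> S a \<and> g a \<le> s" s] Least_le[of "\<lambda>s. s \<in> S a \<and> g a \<le> s" s] assms
  unfolding round_up_def by auto

text \<open>
  If no \<open>f \<beta>\<close> works, build a continuous sequence \<open>\<xi>\<close> of length \<open>\<Lambda>\<close> such that the rounding of \<open>f (\<xi> i)\<close>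
  fails to bound \<open>f (\<xi> j)\<close> for \<open>i < j\<close>, and such that any of the \<open>\<Lambda>\<close> guesses \<open>C \<alpha>\<close> whose part up to \<open>i\<close>
  has its pointwise supremum bounded by some \<open>f s\<close> has one such \<open>s\<close> (called \<open>\<sigma> \<xi> \<alpha> i\<close>) below \<open>\<xi> (i + 1)\<close>.
  At the supremum \<open>\<delta>\<close> of \<open>\<xi>\<close> some \<open>C \<alpha>\<close> lies in the set on which \<open>\<xi>\<close> agrees with \<open>cof_seq \<delta>\<close>, so these bounds
  exist.  Then for \<open>\<mu>\<close> many points of \<open>C \<alpha>\<close> a single coordinate \<open>a\<close> sees strictly increasing roundings,
  too many for \<open>S a\<close>.
\<close>

lemma bounding_projection:
  fixes f :: "'a::wellorder \<Rightarrow> 'i \<Rightarrow> 'a"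
  assumes m: "regular_cardinal \<mu>" and m1: "regular_cardinal \<mu>1" and L: "regular_cardinal \<Lambda>"
    and lt: "\<mu> < \<mu>1" "\<mu>1 < \<Lambda>" "\<Lambda> < cof \<rho>"
    and A_ev: "eventually (\<lambda>a. a \<in> A) F" and A_small: "|A| <o osegment \<mu>"
    and inc: "\<And>\<beta> \<gamma>. \<beta> < \<gamma> \<Longrightarrow> \<gamma> < \<rho> \<Longrightarrow> eventually (\<lambda>a. f \<beta> a < f \<gamma> a) F"
    and bd: "\<And>\<delta>. \<delta> < \<rho> \<Longrightarrow> cof \<delta> = \<Lambda> \<Longrightarrow>
      \<exists>d<\<rho>. eventually (\<lambda>a. \<forall>i<\<Lambda>. f (cof_seq \<delta> i) a < f d a) F"
    and S_small: "\<And>a. a \<in> A \<Longrightarrow> |S a| <o osegment \<mu>"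
    and S_bound: "\<And>a \<beta>. a \<in> A \<Longrightarrow> \<beta> < \<rho> \<Longrightarrow> \<exists>s\<in>S a. f \<beta> a \<le> s"
  shows "\<exists>\<beta><\<rho>. \<forall>\<gamma><\<rho>. eventually (\<lambda>a. f \<gamma> a \<le> round_up S (f \<beta>) a) F"
proof (rule ccontr)
  assume neg: "\<not> ?thesis"
  then have "\<forall>\<beta>. \<exists>\<gamma>. \<beta> < \<rho> \<longrightarrow> \<gamma> < \<rho> \<and> \<not> eventually (\<lambda>a. f \<gamma> a \<le> round_up S (f \<beta>) a) F" by blast
  then obtain nx where nx: "\<And>\<beta>. \<beta> < \<rho> \<Longrightarrow> nx \<beta> < \<rho>"
    "\<And>\<beta>. \<beta> < \<rho> \<Longrightarrow> \<not> eventually (\<lambda>a. f (nx \<beta>) a \<le> round_up S (f \<beta>) a) F" by metis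
  from club_guessing[OF m m1 L lt(1,2)] obtain C where
    C: "\<And>G. (\<And>x. x < \<Lambda> \<Longrightarrow> G x < \<Lambda>) \<Longrightarrow> \<exists>\<alpha><\<Lambda>. cof \<alpha> = \<mu> \<and> C \<alpha> \<subseteq> {..<\<alpha>} \<and>
      (\<forall>x<\<alpha>. \<exists>y\<in>C \<alpha>. x < y) \<and> (\<forall>i\<in>C \<alpha>. \<forall>x<i. G x < i)" by blast
  have lim_rho: "is_limit \<rho>" using is_limit_of_regular_le_cof[OF L] lt by simp
  have above: "\<exists>z<\<rho>. y < z" if "y < \<rho>" for y using lim_rho that unfolding is_limit_def by blast
  define Q where "Q = (\<lambda>\<xi> \<alpha> i s. s < \<rho> \<and> eventually (\<lambda>a. \<forall>k\<in>C \<alpha>. k \<le> i \<longrightarrow> f (\<xi> k) a \<le> f s a) F)"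
  \<comment> \<open>The default \<open>\<xi> i\<close> only keeps the value below
    \<open>\<rho>\<close> where no bound exists.\<close>
  define \<sigma> where "\<sigma> = (\<lambda>\<xi> \<alpha> i. if \<exists>s. Q \<xi> \<alpha> i s then SOME s. Q \<xi> \<alpha> i s else \<xi> i)"
  define N where "N = (\<lambda>\<xi> i. LEAST r. \<xi> i < r \<and> nx (\<xi> i) < r \<and> (\<forall>\<alpha><\<Lambda>. \<sigma> \<xi> \<alpha> i < r))"
  have \<sigma>_Q: "Q \<xi> \<alpha> i (\<sigma> \<xi> \<alpha> i)" if "Q \<xi> \<alpha> i s" for \<xi> \<alpha> i s
    unfolding \<sigma>_def using that someI[of "Q \<xi> \<alpha> i" s] by auto
  have \<sigma>_lt: "\<sigma> \<xi> \<alpha> i < \<rho>" if "\<xi> i < \<rho>" for \<xi> \<alpha> i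
  proof (cases "\<exists>s. Q \<xi> \<alpha> i s")
    case True
    then show ?thesis using \<sigma>_Q Q_def by blast
  next
    case False
    then have "\<sigma> \<xi> \<alpha> i = \<xi> i" unfolding \<sigma>_def by auto
    then show ?thesis using that by simp
  qed
  have N: "\<xi> i < N \<xi> i \<and> nx (\<xi> i) < N \<xi> i \<and> (\<forall>\<alpha><\<Lambda>. \<sigma> \<xi> \<alpha> i < N \<xi> i) \<and> N \<xi> i < \<rho>"
    if xi: "\<xi> i < \<rho>" for \<xi> i
  proof -
    \<comment> \<open>Passing the bounds for all \<open>\<Lambda>\<close> guesses at once is
      possible since \<open>\<Lambda> < cof \<rho>\<close>.\<close>
    have "\<exists>b<\<rho>. \<forall>y\<in>(\<lambda>\<alpha>. \<sigma> \<xi> \<alpha> i) ` {..<\<Lambda>}. y < b"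
      using \<sigma>_lt xi by (intro small_bounded card_image_lessThan_less[OF lt(3)]) auto
    then obtain b where b: "b < \<rho>" "\<And>\<alpha>. \<alpha> < \<Lambda> \<Longrightarrow> \<sigma> \<xi> \<alpha> i < b" by auto
    have "max b (max (\<xi> i) (nx (\<xi> i))) < \<rho>" using b nx(1)[OF xi] xi by auto
    then obtain z where z: "z < \<rho>" "max b (max (\<xi> i) (nx (\<xi> i))) < z" using above by blast
    have Pz: "\<xi> i < z \<and> nx (\<xi> i) < z \<and> (\<forall>\<alpha><\<Lambda>. \<sigma> \<xi> \<alpha> i < z)" using z b(2) by (auto intro: less_trans)
    have "\<xi> i < N \<xi> i \<and> nx (\<xi> i) < N \<xi> i \<and> (\<forall>\<alpha><\<Lambda>. \<sigma> \<xi> \<alpha> i < N \<xi> i)"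
      unfolding N_def by (rule LeastI[of _ z]) (rule Pz)
    moreover have "N \<xi> i \<le> z" unfolding N_def by (rule Least_le) (rule Pz)
    ultimately show ?thesis using z(1) by simp
  qed
  \<comment> \<open>The restriction to \<open>k \<le> i\<close> in \<open>Q\<close> is what lets the
    recursion run: the later terms of \<open>\<xi>\<close> are not yet known at stage
    \<open>i\<close>.\<close>
  have N_adm: "N \<xi> i = N \<zeta> i" if "\<And>j. j \<le> i \<Longrightarrow> \<xi> j = \<zeta> j" for \<xi> \<zeta> i
  proof -
    have "(\<lambda>a. \<forall>k\<in>C \<alpha>. k \<le> i \<longrightarrow> f (\<xi> k) a \<le> f s a) = (\<lambda>a. \<forall>k\<in>C \<alpha>. k \<le> i \<longrightarrow> f (\<zeta> k) a \<le> f s a)" for \<alpha> s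
      using that by auto
    then have Q_eq: "Q \<xi> \<alpha> i = Q \<zeta> \<alpha> i" for \<alpha> unfolding Q_def by simp
    have "\<sigma> \<xi> \<alpha> i = \<sigma> \<zeta> \<alpha> i" for \<alpha> unfolding \<sigma>_def by (simp only: Q_eq that[OF order_refl])
    then show ?thesis unfolding N_def using that[of i] by simp
  qed
  have ne: "{..<\<rho>} \<noteq> {}" using lim_rho unfolding is_limit_def by blast
  obtain \<xi> where \<xi>: "\<And>i. i < \<Lambda> \<Longrightarrow> \<xi> i < \<rho>" "normal_on \<Lambda> \<xi>"
    and \<xi>N: "\<And>i j. i < j \<Longrightarrow> j < \<Lambda> \<Longrightarrow> N \<xi> i \<le> \<xi> j"
  proof (rule normal_sequence[of N \<Lambda> \<rho>])
    show "N \<xi> k = N \<zeta> k" if "\<And>j. j \<le> k \<Longrightarrow> \<xi> j = \<zeta> j" for \<xi> \<zeta> k using N_adm that by blast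
    show "\<xi> k < N \<xi> k \<and> N \<xi> k < \<rho>" if "k < \<Lambda>" "\<And>j. j \<le> k \<Longrightarrow> \<xi> j < \<rho>" for \<xi> k
      using N that by blast
  qed (use lt(3) ne in auto)
  have sm: "strict_mono_on {..<\<Lambda>} \<xi>" using \<xi>(2) unfolding normal_on_def by blast
  from limit_of_sequence[OF L sm lt(3) \<xi>(1)] obtain \<delta> where
    \<delta>: "\<delta> < \<rho>" "cof \<delta> = \<Lambda>" "\<And>i. i < \<Lambda> \<Longrightarrow> \<xi> i < \<delta>" "\<And>y. y < \<delta> \<Longrightarrow> \<exists>i<\<Lambda>. y < \<xi> i" by blast
  have lim_d: "is_limit \<delta>" using is_limit_of_regular_le_cof[OF L] \<delta> by simp
  have e: "normal_on \<Lambda> (cof_seq \<delta>)" "\<And>i. i < \<Lambda> \<Longrightarrow> cof_seq \<delta> i < \<delta>" "\<And>y. y < \<delta> \<Longrightarrow> \<exists>i<\<Lambda>. y < cof_seq \<delta> i"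
    using cof_seq[OF lim_d] \<delta>(2) by auto
  obtain G where G: "\<And>x. x < \<Lambda> \<Longrightarrow> G x < \<Lambda>"
    "\<And>i. i < \<Lambda> \<Longrightarrow> (\<And>x. x < i \<Longrightarrow> G x < i) \<Longrightarrow> \<xi> i = cof_seq \<delta> i"
    using normal_agree[OF \<xi>(2) e(1) regular_is_limit[OF L]] e \<delta> by blast
  have "\<exists>\<alpha><\<Lambda>. cof \<alpha> = \<mu> \<and> C \<alpha> \<subseteq> {..<\<alpha>} \<and>
      (\<forall>x<\<alpha>. \<exists>y\<in>C \<alpha>. x < y) \<and> (\<forall>i\<in>C \<alpha>. \<forall>x<i. G x < i)"
    by (rule C) (rule G(1))
  then obtain \<alpha> where \<alpha>: "\<alpha> < \<Lambda>" "cof \<alpha> = \<mu>" "C \<alpha> \<subseteq> {..<\<alpha>}" "\<And>x. x < \<alpha> \<Longrightarrow> \<exists>y\<in>C \<alpha>. x < y"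
    "\<And>i x. i \<in> C \<alpha> \<Longrightarrow> x < i \<Longrightarrow> G x < i"
    by blast
  have C_lt: "i < \<alpha> \<and> i < \<Lambda>" if "i \<in> C \<alpha>" for i using \<alpha>(1,3) that by (auto intro: less_trans)
  have C_eq: "\<xi> i = cof_seq \<delta> i" if "i \<in> C \<alpha>" for i using G(2)[of i] \<alpha>(5)[OF that] C_lt[OF that] by blast
  obtain d where d: "d < \<rho>" "eventually (\<lambda>a. \<forall>i<\<Lambda>. f (cof_seq \<delta> i) a < f d a) F"
    using bd[OF \<delta>(1,2)] by blast
  \<comment> \<open>\<open>d\<close> bounds \<open>f\<close> along \<open>cof_seq \<delta>\<close>,
    which agrees with \<open>\<xi>\<close> on \<open>C \<alpha>\<close>, so \<open>\<sigma>\<close>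
    never takes its default for this \<open>\<alpha>\<close>.\<close>
  have "Q \<xi> \<alpha> i d" for i
    unfolding Q_def using d(1) eventually_mono[OF d(2)] C_eq C_lt by (simp add: less_imp_le)
  then have \<sigma>_C: "Q \<xi> \<alpha> i (\<sigma> \<xi> \<alpha> i)" for i using \<sigma>_Q by blast
  define s where "s = (\<lambda>i. LEAST j. j \<in> C \<alpha> \<and> i < j)"
  have s: "s i \<in> C \<alpha>" "i < s i" if "i \<in> C \<alpha>" for i
    unfolding s_def using LeastI_ex[of "\<lambda>j. j \<in> C \<alpha> \<and> i < j"] \<alpha>(4)[of i] C_lt[OF that] by blast+
  have s_le: "s i \<le> j" if "j \<in> C \<alpha>" "i < j" for i j unfolding s_def using that by (intro Least_le) blast
  \<comment> \<open>Through \<open>\<sigma> \<xi> \<alpha> i\<close>, the value at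
    \<open>s i\<close> is eventually above all values at points of \<open>C \<alpha>\<close> up to
    \<open>i\<close> simultaneously. The rounding at \<open>s i\<close> does not eventually bound
    the value at \<open>s (s i)\<close>, so some coordinate sees both.\<close>
  have "\<exists>a\<in>A. (\<forall>k\<in>C \<alpha>. k \<le> i \<longrightarrow> f (\<xi> k) a < f (\<xi> (s i)) a) \<and> round_up S (f (\<xi> (s i))) a < f (\<xi> (s (s i))) a"
    if i: "i \<in> C \<alpha>" for i
  proof (rule ccontr)
    assume no: "\<not> ?thesis"
    have si: "s i \<in> C \<alpha>" "s (s i) \<in> C \<alpha>" "i < s i" "s i < s (s i)" using s i by blast+
    have lts: "i < \<Lambda>" "s i < \<Lambda>" "s (s i) < \<Lambda>" using C_lt i si by blast+
    have "\<sigma> \<xi> \<alpha> i < \<xi> (s i)" using N[of \<xi> i, OF \<xi>(1)[OF lts(1)]] \<alpha>(1) \<xi>N[OF si(3) lts(2)] by (meson less_le_trans)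
    then have "eventually (\<lambda>a. f (\<sigma> \<xi> \<alpha> i) a < f (\<xi> (s i)) a) F" using inc \<xi>(1)[OF lts(2)] by blast
    moreover have "nx (\<xi> (s i)) < \<xi> (s (s i))" using N[of \<xi> "s i", OF \<xi>(1)[OF lts(2)]] \<xi>N[OF si(4) lts(3)] by (meson less_le_trans)
    then have "eventually (\<lambda>a. f (nx (\<xi> (s i))) a < f (\<xi> (s (s i))) a) F" using inc \<xi>(1)[OF lts(3)] by blast
    moreover have "eventually (\<lambda>a. \<forall>k\<in>C \<alpha>. k \<le> i \<longrightarrow> f (\<xi> k) a \<le> f (\<sigma> \<xi> \<alpha> i) a) F"
      using \<sigma>_C[of i] unfolding Q_def by blast
    ultimately have "eventually (\<lambda>a. f (nx (\<xi> (s i))) a \<le> round_up S (f (\<xi> (s i))) a) F"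
      using A_ev
    proof eventually_elim
      case (elim a)
      have "\<forall>k\<in>C \<alpha>. k \<le> i \<longrightarrow> f (\<xi> k) a < f (\<xi> (s i)) a" using elim(1,3) by (meson le_less_trans)
      then have "f (\<xi> (s (s i))) a \<le> round_up S (f (\<xi> (s i))) a" using no elim(4) not_less by blast
      then show ?case using elim(2) by simp
    qed
    then show False using nx(2) \<xi>(1)[OF lts(2)] by blast
  qed
  then obtain p where p: "\<And>i. i \<in> C \<alpha> \<Longrightarrow> p i \<in> A"
    "\<And>i k. i \<in> C \<alpha> \<Longrightarrow> k \<in> C \<alpha> \<Longrightarrow> k \<le> i \<Longrightarrow> f (\<xi> k) (p i) < f (\<xi> (s i)) (p i)"
    "\<And>i. i \<in> C \<alpha> \<Longrightarrow> round_up S (f (\<xi> (s i))) (p i) < f (\<xi> (s (s i))) (p i)" by metis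
  \<comment> \<open>Pigeonhole: \<open>A\<close> has fewer than \<open>cof \<alpha> = \<mu>\<close>
    elements, so one coordinate occurs cofinally often.\<close>
  have "\<exists>a\<in>A. \<forall>x<\<alpha>. \<exists>i\<in>C \<alpha>. x < i \<and> p i = a"
  proof (rule ccontr)
    assume "\<not> ?thesis"
    then have "\<forall>a\<in>A. \<exists>x<\<alpha>. \<forall>i\<in>C \<alpha>. p i = a \<longrightarrow> \<not> x < i" by blast
    then obtain b where b: "\<And>a. a \<in> A \<Longrightarrow> b a < \<alpha>" "\<And>a i. a \<in> A \<Longrightarrow> i \<in> C \<alpha> \<Longrightarrow> p i = a \<Longrightarrow> \<not> b a < i" by metis
    have "|b ` A| <o osegment (cof \<alpha>)" using card_of_image A_small ordLeq_ordLess_trans unfolding \<alpha>(2) by blast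
    then have "\<exists>c<\<alpha>. \<forall>y\<in>b ` A. y < c" by (rule small_bounded) (use b(1) in auto)
    then obtain c where c: "c < \<alpha>" "\<And>a. a \<in> A \<Longrightarrow> b a < c" by blast
    obtain i where i: "i \<in> C \<alpha>" "c < i" using \<alpha>(4)[OF c(1)] by blast
    then show False using b(2)[OF p(1)[OF i(1)] i(1) refl] c(2)[OF p(1)[OF i(1)]] by (meson less_trans)
  qed
  then obtain a where a: "a \<in> A" "\<And>x. x < \<alpha> \<Longrightarrow> \<exists>i\<in>C \<alpha>. x < i \<and> p i = a" by blast
  define B where "B = {i \<in> C \<alpha>. p i = a}"
  define v where "v = (\<lambda>i. round_up S (f (\<xi> (s i))) a)"
  have S_ex: "\<exists>t\<in>S a. f (\<xi> i) a \<le> t" if "i \<in> C \<alpha>" for i using S_bound[OF a(1)] \<xi>(1) C_lt[OF that] by blast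
  have v_less: "v i < v j" if "i \<in> B" "j \<in> B" "i < j" for i j
  proof -
    have ij: "i \<in> C \<alpha>" "p i = a" "j \<in> C \<alpha>" "p j = a" using that(1,2) unfolding B_def by blast+
    note s1 = s[OF ij(1)] and s2 = s[OF ij(3)]
    have "v i < f (\<xi> (s (s i))) a" using p(3)[OF ij(1)] ij unfolding v_def by simp
    also have "f (\<xi> (s (s i))) a \<le> f (\<xi> (s j)) a"
    proof (cases "s (s i) \<le> j")
      case True
      then show ?thesis using p(2)[OF ij(3) s(1)[OF s1(1)]] ij by simp
    next
      case False
      \<comment> \<open>Here \<open>j = s i\<close>, and the two sides coincide.\<close>
      have "s i \<le> j" using s_le ij(3) that(3) by blast
      moreover have "\<not> s i < j" using s_le[OF ij(3), of "s i"] False by blast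
      ultimately show ?thesis by (metis order_refl order_le_less)
    qed
    also have "f (\<xi> (s j)) a \<le> v j"
      using S_ex[OF s2(1)] le_round_up unfolding v_def by metis
    finally show ?thesis .
  qed
  have "inj_on v B" by (intro linorder_inj_onI') (use v_less in force)
  moreover have "v i \<in> S a" if "i \<in> B" for i
  proof -
    have "s i \<in> C \<alpha>" using that s(1) unfolding B_def by blast
    from S_ex[OF this] obtain t where "t \<in> S a" "f (\<xi> (s i)) a \<le> t" by blast
    then show ?thesis unfolding v_def by (rule round_up_in)
  qed
  then have "v ` B \<subseteq> S a" by blast
  ultimately have "|B| \<le>o |S a|" using card_of_ordLeq by blast
  then have "|B| <o osegment (cof \<alpha>)" using S_small[OF a(1)] ordLeq_ordLess_trans unfolding \<alpha>(2) by blast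
  then have "\<exists>c<\<alpha>. \<forall>y\<in>B. y < c" by (rule small_bounded) (use C_lt B_def in auto)
  then obtain c where c: "c < \<alpha>" "\<And>i. i \<in> B \<Longrightarrow> i < c" by blast
  obtain i where i: "i \<in> C \<alpha>" "c < i" "p i = a" using a(2)[OF c(1)] by blast
  then have "i \<in> B" unfolding B_def by simp
  then show False using c(2)[of i] i(2) by simp
qed

subsection \<open>Exact upper bounds\<close>

text \<open>\<open>bounding\<close> is the bounding projection property as a hypothesis. Having
  \<open>B a\<close> in \<open>S a\<close> ensures that every \<open>f \<beta>\<close> can be
  rounded up into \<open>S\<close>.\<close>

locale rounding_sequence =
  fixes F :: "'i filter" and A :: "'i set" and f :: "'a::wellorder \<Rightarrow> 'i \<Rightarrow> 'a"
    and B :: "'i \<Rightarrow> 'a" and \<rho> \<mu> :: 'a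
  assumes regular: "regular_cardinal \<mu>" and lt_cof: "\<mu> < cof \<rho>"
    and A_ev: "eventually (\<lambda>a. a \<in> A) F" and A_small: "|A| <o osegment \<mu>"
    and inc: "\<And>\<beta> \<gamma>. \<beta> < \<gamma> \<Longrightarrow> \<gamma> < \<rho> \<Longrightarrow> eventually (\<lambda>a. f \<beta> a < f \<gamma> a) F"
    and bound: "\<And>a \<beta>. a \<in> A \<Longrightarrow> \<beta> < \<rho> \<Longrightarrow> f \<beta> a < B a"
    and bounding: "\<And>S. (\<And>a. a \<in> A \<Longrightarrow> |S a| <o osegment \<mu> \<and> B a \<in> S a) \<Longrightarrow>
      \<exists>\<beta><\<rho>. \<forall>\<gamma><\<rho>. eventually (\<lambda>a. f \<gamma> a \<le> round_up S (f \<beta>) a) F"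
begin

definition upper :: "('i \<Rightarrow> 'a) \<Rightarrow> bool" where
  "upper u \<longleftrightarrow> (\<forall>\<gamma><\<rho>. eventually (\<lambda>a. f \<gamma> a \<le> u a) F)"

lemma limit: "is_limit \<rho>"
  using is_limit_of_regular_le_cof[OF regular] lt_cof by simp

lemma inc_le: "\<beta> \<le> \<gamma> \<Longrightarrow> \<gamma> < \<rho> \<Longrightarrow> eventually (\<lambda>a. f \<beta> a \<le> f \<gamma> a) F"
  using eventually_mono[OF inc[of \<beta> \<gamma>]] order_le_less[of \<beta> \<gamma>] by auto

text \<open>
  If the rounding to \<open>S\<close> is never a least upper bound, add the values of a smaller upper bound to \<open>S\<close>
  and repeat \<open>\<mu>\<close> times.  Rounding one fixed \<open>f \<gamma>\<close> to the growing sets gives decreasing ordinals in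
  each coordinate, which stabilize simultaneously before \<open>\<mu>\<close>.
\<close>

lemma exists_lub: "\<exists>g. (\<forall>a\<in>A. g a \<le> B a) \<and> upper g \<and> (\<forall>u. upper u \<longrightarrow> eventually (\<lambda>a. g a \<le> u a) F)"
proof (rule ccontr)
  assume none: "\<not> ?thesis"
  define ok where "ok = (\<lambda>S. \<forall>a\<in>A. |S a| <o osegment \<mu> \<and> B a \<in> S a)"
  have "\<exists>\<beta>. ok S \<longrightarrow> \<beta> < \<rho> \<and> upper (round_up S (f \<beta>))" for S
    using bounding[of S] unfolding ok_def upper_def by blast
  then obtain b where b: "\<And>S. ok S \<Longrightarrow> b S < \<rho>" "\<And>S. ok S \<Longrightarrow> upper (round_up S (f (b S)))" by metis
  define T where "T = (\<lambda>(u :: 'a \<Rightarrow> 'i \<Rightarrow> 'a) (\<alpha> :: 'a) a. insert (B a) ((\<lambda>\<gamma>. u \<gamma> a) ` {..<\<alpha>}))"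
  have ok: "ok (T u \<alpha>)" if "\<alpha> < \<mu>" for u \<alpha>
    unfolding ok_def
  proof
    fix a
    have "|{B a}| <o osegment \<mu>" by (rule small_finite[OF regular]) simp
    then have "|{B a} \<union> (\<lambda>\<gamma>. u \<gamma> a) ` {..<\<alpha>}| <o osegment \<mu>"
      using small_Un[OF regular] card_image_lessThan_less[OF that] by blast
    then show "|T u \<alpha> a| <o osegment \<mu> \<and> B a \<in> T u \<alpha> a" unfolding T_def by simp
  qed
  have pB: "f \<beta> a \<le> round_up (T u \<alpha>) (f \<beta>) a \<and> round_up (T u \<alpha>) (f \<beta>) a \<le> B a" if "a \<in> A" "\<beta> < \<rho>" for u \<alpha> a \<beta>
    using le_round_up[of "B a" "T u \<alpha>" a "f \<beta>"] round_up_le[of "B a" "T u \<alpha>" a "f \<beta>"] bound[OF that]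
    unfolding T_def by auto
  \<comment> \<open>Stage \<open>\<alpha>\<close> picks an upper bound witnessing that the current
    rounding is not least.\<close>
  define P where "P = (\<lambda>u \<alpha> r. \<alpha> < \<mu> \<longrightarrow> upper r \<and>
    \<not> eventually (\<lambda>a. round_up (T u \<alpha>) (f (b (T u \<alpha>))) a \<le> r a) F)"
  have "\<exists>u. \<forall>\<alpha>. P u \<alpha> (u \<alpha>)"
  proof (rule dependent_wellorder_choice[where P = P])
    fix r and v w :: "'a \<Rightarrow> 'i \<Rightarrow> 'a" and \<alpha>
    assume "\<And>y. y < \<alpha> \<Longrightarrow> v y = w y"
    then have "T v \<alpha> = T w \<alpha>" unfolding T_def by auto
    then show "P v \<alpha> r = P w \<alpha> r" unfolding P_def by simp
  next
    fix \<alpha> and u :: "'a \<Rightarrow> 'i \<Rightarrow> 'a"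
    show "\<exists>r. P u \<alpha> r"
    proof (cases "\<alpha> < \<mu>")
      case True
      show ?thesis using none b[OF ok[OF True, of u]] pB unfolding P_def by blast
    next
      case False
      then show ?thesis unfolding P_def by blast
    qed
  qed
  then obtain u where u: "\<And>\<alpha>. \<alpha> < \<mu> \<Longrightarrow> upper (u \<alpha>)"
    "\<And>\<alpha>. \<alpha> < \<mu> \<Longrightarrow> \<not> eventually (\<lambda>a. round_up (T u \<alpha>) (f (b (T u \<alpha>))) a \<le> u \<alpha> a) F"
    unfolding P_def by blast
  \<comment> \<open>All \<open>\<mu>\<close> stages are compared through a single
    \<open>f \<gamma>\<close>, available because \<open>\<mu> < cof \<rho>\<close>.\<close>
  have "\<exists>\<gamma><\<rho>. \<forall>y\<in>(\<lambda>\<alpha>. b (T u \<alpha>)) ` {..<\<mu>}. y < \<gamma>"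
    using b(1) ok by (intro small_bounded card_image_lessThan_less lt_cof) auto
  then obtain \<gamma> where \<gamma>: "\<gamma> < \<rho>" "\<And>\<alpha>. \<alpha> < \<mu> \<Longrightarrow> b (T u \<alpha>) < \<gamma>" by auto
  have anti: "round_up (T u \<beta>) (f \<gamma>) a \<le> round_up (T u \<alpha>) (f \<gamma>) a" if a: "a \<in> A" and "\<alpha> \<le> \<beta>" for a \<alpha> \<beta>
  proof (rule round_up_le)
    have "B a \<in> T u \<alpha> a" unfolding T_def by simp
    from round_up_in[of "B a" "T u \<alpha>" a "f \<gamma>", OF this] have "round_up (T u \<alpha>) (f \<gamma>) a \<in> T u \<alpha> a" using bound[OF a \<gamma>(1)] by simp
    then show "round_up (T u \<alpha>) (f \<gamma>) a \<in> T u \<beta> a" unfolding T_def using that(2) by (auto intro: less_le_trans)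
    show "f \<gamma> a \<le> round_up (T u \<alpha>) (f \<gamma>) a" using pB[OF a \<gamma>(1)] by blast
  qed
  obtain \<alpha> \<beta> where ab: "\<alpha> < \<beta>" "\<beta> < \<mu>" "\<And>a. a \<in> A \<Longrightarrow> round_up (T u \<beta>) (f \<gamma>) a = round_up (T u \<alpha>) (f \<gamma>) a"
    using antimono_stabilizes[OF regular A_small, of "\<lambda>a \<alpha>. round_up (T u \<alpha>) (f \<gamma>) a"] anti by blast
  have am: "\<alpha> < \<mu>" using ab by (meson less_trans)
  define c where "c = b (T u \<alpha>)"
  have c: "c < \<gamma>" "c < \<rho>" using \<gamma>(2)[OF am] \<gamma>(1) unfolding c_def by auto
  have "eventually (\<lambda>a. f c a \<le> f \<gamma> a) F" using inc_le c(1) \<gamma>(1) by simp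
  moreover have "eventually (\<lambda>a. f \<gamma> a \<le> u \<alpha> a) F" using u(1)[OF am] \<gamma>(1) unfolding upper_def by blast
  \<comment> \<open>\<open>u \<alpha> a\<close> belongs to \<open>T u \<beta> a\<close> since
    \<open>\<alpha> < \<beta>\<close>, so rounding \<open>f \<gamma>\<close> into the later set
    stays at or below it. By stabilization the same holds for the earlier set, contrary to the
    choice of \<open>u \<alpha>\<close>.\<close>
  ultimately have "eventually (\<lambda>a. round_up (T u \<alpha>) (f c) a \<le> u \<alpha> a) F" using A_ev
  proof eventually_elim
    case (elim a)
    have "B a \<in> T u \<alpha> a" unfolding T_def by simp
    from round_up_in[of "B a" "T u \<alpha>" a "f \<gamma>", OF this] have i: "round_up (T u \<alpha>) (f \<gamma>) a \<in> T u \<alpha> a" using bound[OF elim(3) \<gamma>(1)] by simp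
    have "f c a \<le> round_up (T u \<alpha>) (f \<gamma>) a" using pB[OF elim(3) \<gamma>(1)] elim(1) by (meson order_trans)
    from round_up_le[of _ "T u \<alpha>" a "f c", OF i this] have "round_up (T u \<alpha>) (f c) a \<le> round_up (T u \<alpha>) (f \<gamma>) a" .
    also have "\<dots> = round_up (T u \<beta>) (f \<gamma>) a" using ab(3) elim(3) by simp
    also have "\<dots> \<le> u \<alpha> a" by (rule round_up_le) (use elim(2) ab(1) T_def in auto)
    finally show ?case .
  qed
  then show False using u(2)[OF am] unfolding c_def by blast
qed

end

locale least_bounded_sequence = rounding_sequence F A f B \<rho> \<mu>
  for F :: "'i filter" and A and f :: "'a::wellorder \<Rightarrow> 'i \<Rightarrow> 'a" and B \<rho> \<mu> +
  fixes g :: "'i \<Rightarrow> 'a"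
  assumes g_upper: "upper g" and g_least: "\<And>u. upper u \<Longrightarrow> eventually (\<lambda>a. g a \<le> u a) F"
begin

lemma less_lub:
  assumes "\<gamma> < \<rho>"
  shows "eventually (\<lambda>a. f \<gamma> a < g a) F"
proof -
  obtain \<gamma>' where \<gamma>': "\<gamma> < \<gamma>'" "\<gamma>' < \<rho>" using limit assms unfolding is_limit_def by blast
  then have "eventually (\<lambda>a. f \<gamma>' a \<le> g a) F" using g_upper unfolding upper_def by blast
  with inc[OF \<gamma>'] show ?thesis by eventually_elim simp
qed

text \<open>The rounding given by \<open>bounding\<close> is an upper bound, so it eventually lies
  at or above \<open>g\<close>. Below, \<open>S a\<close> is taken to be a singleton for
  \<open>exact\<close> and a short cofinal subset of \<open>g a\<close> for
  \<open>le_cof_lub\<close>.\<close>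

lemma lub_le_round_up:
  assumes "\<And>a. a \<in> A \<Longrightarrow> |S a| <o osegment \<mu>"
  shows "\<exists>\<beta><\<rho>. eventually (\<lambda>a. g a \<le> round_up (\<lambda>a. insert (B a) (S a)) (f \<beta>) a) F"
proof -
  have "|insert (B a) (S a)| <o osegment \<mu>" if "a \<in> A" for a
    using small_Un[OF regular small_finite[OF regular] assms[OF that], of "{B a}"] by simp
  then have "\<exists>\<beta><\<rho>. \<forall>\<gamma><\<rho>. eventually (\<lambda>a. f \<gamma> a \<le> round_up (\<lambda>a. insert (B a) (S a)) (f \<beta>) a) F"
    by (intro bounding) simp
  then show ?thesis using g_least unfolding upper_def by blast
qed

text \<open>Round into \<open>{d a, B a}\<close>: where \<open>f \<beta> a \<le> d a\<close>, the
  result would be at most \<open>d a < g a\<close>.\<close>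

lemma exact:
  assumes "eventually (\<lambda>a. d a < g a) F"
  obtains \<beta> where "\<beta> < \<rho>" "eventually (\<lambda>a. d a < f \<beta> a) F"
proof -
  have "\<exists>\<beta><\<rho>. eventually (\<lambda>a. g a \<le> round_up (\<lambda>a. insert (B a) {d a}) (f \<beta>) a) F"
    by (rule lub_le_round_up) (rule small_finite[OF regular], simp)
  then obtain \<beta> where
    \<beta>: "\<beta> < \<rho>" "eventually (\<lambda>a. g a \<le> round_up (\<lambda>a. insert (B a) {d a}) (f \<beta>) a) F" by blast
  from \<beta>(2) assms have "eventually (\<lambda>a. d a < f \<beta> a) F"
  proof eventually_elim
    case (elim a)
    show ?case
    proof (rule ccontr)
      assume "\<not> ?case"
      then have "round_up (\<lambda>a. insert (B a) {d a}) (f \<beta>) a \<le> d a" by (intro round_up_le) auto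
      then show False using elim by simp
    qed
  qed
  then show thesis using that \<beta>(1) by blast
qed

text \<open>Where \<open>cof (g a) < \<mu>\<close>, a cofinal subset of \<open>g a\<close> is small
  enough to serve as \<open>S a\<close>. Rounding a value below \<open>g a\<close> into it would
  stay below \<open>g a\<close>.\<close>

lemma le_cof_lub: "eventually (\<lambda>a. \<mu> \<le> cof (g a)) F"
proof -
  have "\<exists>h. h ` {..<cof x} \<subseteq> {..<x} \<and> (\<forall>y<x. \<exists>i<cof x. y \<le> h i)" for x :: 'a using cof_witness .
  then obtain h where h: "\<And>x. h x ` {..<cof x} \<subseteq> {..<x}" "\<And>x y :: 'a. y < x \<Longrightarrow> \<exists>i<cof x. y \<le> h x i" by metis
  define S where "S = (\<lambda>a. if cof (g a) < \<mu> then h (g a) ` {..<cof (g a)} else {})"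
  have S: "|S a| <o osegment \<mu>" for a
    unfolding S_def using card_image_lessThan_less small_finite[OF regular finite.emptyI] by auto
  obtain \<beta> where
    \<beta>: "\<beta> < \<rho>" "eventually (\<lambda>a. g a \<le> round_up (\<lambda>a. insert (B a) (S a)) (f \<beta>) a) F"
    using lub_le_round_up[of S] S by blast
  from \<beta>(2) less_lub[OF \<beta>(1)] show ?thesis
  proof eventually_elim
    case (elim a)
    show ?case
    proof (rule ccontr)
      assume n: "\<not> ?case"
      obtain i where i: "i < cof (g a)" "f \<beta> a \<le> h (g a) i" using h(2)[OF elim(2)] by blast
      have "h (g a) i \<in> insert (B a) (S a)" unfolding S_def using n i(1) by auto
      from round_up_le[of "h (g a) i" "\<lambda>a. insert (B a) (S a)" a "f \<beta>", OF this i(2)] have "g a \<le> h (g a) i" using elim(1) by simp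
      moreover have "h (g a) i < g a" using h(1)[of "g a"] i(1) by auto
      ultimately show False by simp
    qed
  qed
qed

text \<open>Where \<open>cof (g a)\<close> exceeds \<open>cof \<rho>\<close>, the values below
  \<open>g a\<close> along a cofinal sequence of \<open>\<rho>\<close> have a bound
  \<open>b a < g a\<close>. Lowering \<open>g\<close> to \<open>b\<close> at these coordinates
  leaves an upper bound, so leastness makes them negligible.\<close>

lemma cof_lub_le: "eventually (\<lambda>a. cof (g a) \<le> cof \<rho>) F"
proof -
  have "\<exists>b<g a. \<forall>y\<in>{y. y < g a \<and> (\<exists>i<cof \<rho>. y = f (cof_seq \<rho> i) a)}. y < b" if "cof \<rho> < cof (g a)" for a
  proof (rule small_bounded)
    have "{y. y < g a \<and> (\<exists>i<cof \<rho>. y = f (cof_seq \<rho> i) a)} \<subseteq> (\<lambda>i. f (cof_seq \<rho> i) a) ` {..<cof \<rho>}" by auto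
    then show "|{y. y < g a \<and> (\<exists>i<cof \<rho>. y = f (cof_seq \<rho> i) a)}| <o osegment (cof (g a))"
      using small_subset card_image_lessThan_less[OF that] by blast
  qed auto
  then have "\<exists>b. cof \<rho> < cof (g a) \<longrightarrow> b < g a \<and> (\<forall>i<cof \<rho>. f (cof_seq \<rho> i) a < g a \<longrightarrow> f (cof_seq \<rho> i) a < b)" for a
    by blast
  then obtain b where b: "\<And>a. cof \<rho> < cof (g a) \<Longrightarrow> b a < g a"
    "\<And>a i. cof \<rho> < cof (g a) \<Longrightarrow> i < cof \<rho> \<Longrightarrow> f (cof_seq \<rho> i) a < g a \<Longrightarrow> f (cof_seq \<rho> i) a < b a"
    by metis
  define u where "u = (\<lambda>a. if cof \<rho> < cof (g a) then b a else g a)"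
  have "upper u"
    unfolding upper_def
  proof (intro allI impI)
    fix \<gamma> assume "\<gamma> < \<rho>"
    then obtain i where i: "i < cof \<rho>" "\<gamma> < cof_seq \<rho> i" using cof_seq_cofinal[OF limit] by blast
    have l: "cof_seq \<rho> i < \<rho>" using cof_seq_less[OF limit i(1)] .
    from inc[OF i(2) l] less_lub[OF l] show "eventually (\<lambda>a. f \<gamma> a \<le> u a) F"
    proof eventually_elim
      case (elim a)
      then show ?case unfolding u_def using b(2)[OF _ i(1), of a] by auto
    qed
  qed
  from g_least[OF this] show ?thesis
  proof eventually_elim
    case (elim a)
    then show ?case unfolding u_def using b(1)[of a] by (auto simp: not_less[symmetric] split: if_splits)
  qed
qed

text \<open>If this failed, cofinal \<open>\<theta>\<close>-sequences in the \<open>g a\<close>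
  would give functions \<open>d i\<close> below \<open>g\<close>. As
  \<open>\<theta> < cof \<rho>\<close>, one \<open>f \<gamma>\<close> eventually dominates each of
  them; but fewer than \<open>\<theta>\<close> coordinates allow a single \<open>d c\<close> to pass
  \<open>f \<gamma>\<close> wherever the cofinality is \<open>\<theta>\<close>.\<close>

lemma cof_lub_neq:
  assumes "\<mu> \<le> \<theta>" "\<theta> < cof \<rho>"
  shows "eventually (\<lambda>a. cof (g a) \<noteq> \<theta>) F"
proof (cases "\<exists>a. cof (g a) = \<theta>")
  case True
  then obtain a0 where a0: "cof (g a0) = \<theta>" by blast
  have lim: "is_limit (g a)" if "cof (g a) = \<theta>" for a
    using is_limit_of_regular_le_cof[OF regular] that assms(1) by blast
  have reg: "regular_cardinal \<theta>" using regular_cof[OF lim[OF a0]] a0 by simp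
  have A\<theta>: "|A| <o osegment \<theta>"
    using A_small osegment_less_iff[of \<mu> \<theta>] assms(1) ordLess_transitive by (cases "\<mu> = \<theta>") auto
  obtain \<beta>0 where \<beta>0: "\<beta>0 < \<rho>" using limit unfolding is_limit_def by blast
  \<comment> \<open>At other coordinates any value eventually below \<open>g\<close> will do, so
    that \<open>exact\<close> applies.\<close>
  define d where "d = (\<lambda>i a. if cof (g a) = \<theta> then cof_seq (g a) i else f \<beta>0 a)"
  have "\<exists>\<beta><\<rho>. eventually (\<lambda>a. d i a < f \<beta> a) F" if i: "i < \<theta>" for i
  proof -
    from less_lub[OF \<beta>0] have "eventually (\<lambda>a. d i a < g a) F"
    proof eventually_elim
      case (elim a)
      then show ?case unfolding d_def using cof_seq_less[OF lim, of a i] i by auto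
    qed
    from exact[OF this] show ?thesis by blast
  qed
  then have "\<forall>i. \<exists>\<beta>. i < \<theta> \<longrightarrow> \<beta> < \<rho> \<and> eventually (\<lambda>a. d i a < f \<beta> a) F" by blast
  then obtain b where b: "\<And>i. i < \<theta> \<Longrightarrow> b i < \<rho>" "\<And>i. i < \<theta> \<Longrightarrow> eventually (\<lambda>a. d i a < f (b i) a) F" by metis
  have "\<exists>\<gamma><\<rho>. \<forall>y\<in>b ` {..<\<theta>}. y < \<gamma>"
    using b(1) by (intro small_bounded card_image_lessThan_less assms(2)) auto
  then obtain \<gamma> where \<gamma>: "\<gamma> < \<rho>" "\<And>i. i < \<theta> \<Longrightarrow> b i < \<gamma>" by auto
  have "\<forall>a. \<exists>i. i < \<theta> \<and> (cof (g a) = \<theta> \<longrightarrow> f \<gamma> a < g a \<longrightarrow> f \<gamma> a < cof_seq (g a) i)"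
  proof
    fix a
    obtain z where z: "z < \<theta>" using regular_is_limit[OF reg] unfolding is_limit_def by blast
    show "\<exists>i. i < \<theta> \<and> (cof (g a) = \<theta> \<longrightarrow> f \<gamma> a < g a \<longrightarrow> f \<gamma> a < cof_seq (g a) i)"
      using cof_seq_cofinal[OF lim, of a "f \<gamma> a"] z by blast
  qed
  then obtain k where k: "\<And>a. k a < \<theta>"
    "\<And>a. cof (g a) = \<theta> \<Longrightarrow> f \<gamma> a < g a \<Longrightarrow> f \<gamma> a < cof_seq (g a) (k a)" by metis
  have "|k ` A| <o osegment \<theta>" using card_of_image A\<theta> ordLeq_ordLess_trans by blast
  then have "\<exists>c<\<theta>. \<forall>y\<in>k ` A. y < c" by (rule regular_small_bounded[OF reg]) (use k(1) in auto)
  then obtain c where c: "c < \<theta>" "\<And>a. a \<in> A \<Longrightarrow> k a < c" by blast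
  from b(2)[OF c(1)] inc[OF \<gamma>(2)[OF c(1)] \<gamma>(1)] less_lub[OF \<gamma>(1)] A_ev show ?thesis
  proof eventually_elim
    case (elim a)
    show ?case
    proof
      assume t: "cof (g a) = \<theta>"
      have "cof_seq (g a) (k a) < cof_seq (g a) c"
        using normal_on_less[OF cof_seq_normal[OF lim[OF t]] c(2)[OF elim(4)]] c(1) t by simp
      moreover have "cof_seq (g a) c < f (b c) a" using elim(1) t unfolding d_def by simp
      ultimately show False using elim(2) k(2)[OF t elim(3)] by (meson less_asym less_trans)
    qed
  qed
qed simp

end

subsection \<open>Scales\<close>

definition tail_filter :: "'a::wellorder \<Rightarrow> 'a filter" where
  "tail_filter x = (INF j\<in>{..<x}. principal {j..<x})"

lemma eventually_tail:
  assumes "{..<x} \<noteq> {}"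
  shows "eventually P (tail_filter x) \<longleftrightarrow> (\<exists>j<x. \<forall>i. j \<le> i \<and> i < x \<longrightarrow> P i)"
proof -
  have "eventually P (tail_filter x) \<longleftrightarrow> (\<exists>j\<in>{..<x}. eventually P (principal {j..<x}))"
    unfolding tail_filter_def
  proof (rule eventually_INF_base[OF assms])
    fix a b assume "a \<in> {..<x}" "b \<in> {..<x}"
    then show "\<exists>j\<in>{..<x}. principal {j..<x} \<le> inf (principal {a..<x}) (principal {b..<x})"
      by (intro bexI[of _ "max a b"]) auto
  qed
  then show ?thesis unfolding eventually_principal by (simp add: Bex_def Ball_def)
qed

text \<open>In a regular cardinal the small subsets are exactly the bounded ones. This turns
  \<open>scale_less\<close> into an eventual inequality.\<close>

lemma eventually_tail_iff_small:
  assumes "regular_cardinal x"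
  shows "eventually P (tail_filter x) \<longleftrightarrow> |{i. i < x \<and> \<not> P i}| <o osegment x"
proof -
  have ne: "{..<x} \<noteq> {}" using regular_is_limit[OF assms] unfolding is_limit_def by blast
  show ?thesis unfolding eventually_tail[OF ne]
  proof
    assume "\<exists>j<x. \<forall>i. j \<le> i \<and> i < x \<longrightarrow> P i"
    then obtain j where j: "j < x" "\<And>i. j \<le> i \<Longrightarrow> i < x \<Longrightarrow> P i" by blast
    then have "{i. i < x \<and> \<not> P i} \<subseteq> {..<j}" using not_less by blast
    then show "|{i. i < x \<and> \<not> P i}| <o osegment x" using card_lessThan_less[OF j(1)] small_subset by blast
  next
    assume "|{i. i < x \<and> \<not> P i}| <o osegment x"
    then have "\<exists>b<x. \<forall>y\<in>{i. i < x \<and> \<not> P i}. y < b" by (rule regular_small_bounded[OF assms]) auto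
    then show "\<exists>j<x. \<forall>i. j \<le> i \<and> i < x \<longrightarrow> P i" by (metis leD mem_Collect_eq)
  qed
qed

lemma scale_less_iff:
  assumes "regular_cardinal (cof \<kappa>)"
  shows "scale_less \<kappa> f g \<longleftrightarrow> eventually (\<lambda>i. f i < g i) (tail_filter (cof \<kappa>))"
  unfolding scale_less_def eventually_tail_iff_small[OF assms] by (simp add: not_less)

text \<open>Where \<open>cof \<delta> < \<kappa>s a\<close>, regularity of
  \<open>\<kappa>s a\<close> bounds the sequence at \<open>a\<close>. This covers almost all
  coordinates, and the scale dominates the resulting element of the product.\<close>

lemma scale_bounds_short_sequences:
  assumes \<kappa>: "singular_cardinal \<kappa>" and sc: "is_scale \<kappa> \<kappa>p \<kappa>s f" and \<chi>: "regular_cardinal (cof \<kappa>)"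
    and \<delta>: "is_limit \<delta>" "\<delta> < \<kappa>p" "cof \<delta> < \<kappa>"
  shows "\<exists>d<\<kappa>p. eventually (\<lambda>a. \<forall>i<cof \<delta>. f (cof_seq \<delta> i) a < f d a) (tail_filter (cof \<kappa>))"
proof -
  have ne: "{..<cof \<kappa>} \<noteq> {}" using regular_is_limit[OF \<chi>] unfolding is_limit_def by blast
  have reg: "regular_cardinal (\<kappa>s a)" if "a < cof \<kappa>" for a using sc that unfolding is_scale_def by blast
  have sp: "f \<alpha> a < \<kappa>s a" if "\<alpha> < \<kappa>p" "a < cof \<kappa>" for \<alpha> a
    using sc that unfolding is_scale_def scale_product_def by (auto simp: Pi_iff)
  have e: "cof_seq \<delta> i < \<kappa>p" if "i < cof \<delta>" for i using cof_seq_less[OF \<delta>(1) that] \<delta>(2) by (rule less_trans)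
  have "\<exists>b. a < cof \<kappa> \<longrightarrow> b < \<kappa>s a \<and> (cof \<delta> < \<kappa>s a \<longrightarrow> (\<forall>i<cof \<delta>. f (cof_seq \<delta> i) a < b))" for a
  proof (cases "a < cof \<kappa> \<and> cof \<delta> < \<kappa>s a")
    case True
    then have "cof \<delta> < cof (\<kappa>s a)" using cof_regular_cardinal[OF reg] by simp
    then obtain b where "b < \<kappa>s a" "\<And>i. i < cof \<delta> \<Longrightarrow> f (cof_seq \<delta> i) a < b"
      using cof_less_of_small_bound[of "cof \<delta>" "\<kappa>s a" "\<lambda>i. f (cof_seq \<delta> i) a"] sp e True by blast
    then show ?thesis by blast
  next
    case False
    \<comment> \<open>At the remaining coordinates any element of \<open>\<kappa>s a\<close> serves;
      \<open>f \<delta> a\<close> is one.\<close>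
    then show ?thesis using sp[OF \<delta>(2), of a] by blast
  qed
  then obtain b where b: "\<And>a. a < cof \<kappa> \<Longrightarrow> b a < \<kappa>s a"
    "\<And>a i. a < cof \<kappa> \<Longrightarrow> cof \<delta> < \<kappa>s a \<Longrightarrow> i < cof \<delta> \<Longrightarrow> f (cof_seq \<delta> i) a < b a" by metis
  have "b \<in> scale_product \<kappa> \<kappa>s" using b(1) unfolding scale_product_def by auto
  then obtain d where d: "d < \<kappa>p" "scale_less \<kappa> b (f d)" using sc unfolding is_scale_def by blast
  \<comment> \<open>Cofinality of \<open>\<kappa>s\<close> yields only a weak inequality, so a
    strictly larger \<open>z\<close> is inserted.\<close>
  obtain z where z: "cof \<delta> < z" "z < \<kappa>"
    using infinite_cardinal_limit \<delta>(3) \<kappa> unfolding singular_cardinal_def by blast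
  obtain j where j: "j < cof \<kappa>" "z \<le> \<kappa>s j" using sc z(2) unfolding is_scale_def by blast
  have "cof \<delta> < \<kappa>s a" if "j \<le> a" "a < cof \<kappa>" for a
  proof -
    have "strict_mono_on {..<cof \<kappa>} \<kappa>s" using sc unfolding is_scale_def by blast
    then have "\<kappa>s j \<le> \<kappa>s a" using that j(1) strict_mono_on_leD[of "{..<cof \<kappa>}" \<kappa>s j a] by auto
    then show ?thesis using z j by (meson less_le_trans order_trans)
  qed
  then have "eventually (\<lambda>a. a < cof \<kappa> \<and> cof \<delta> < \<kappa>s a) (tail_filter (cof \<kappa>))"
    unfolding eventually_tail[OF ne] using j(1) by blast
  moreover have "eventually (\<lambda>a. b a < f d a) (tail_filter (cof \<kappa>))" using d(2) scale_less_iff[OF \<chi>] by blast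
  ultimately have "eventually (\<lambda>a. \<forall>i<cof \<delta>. f (cof_seq \<delta> i) a < f d a) (tail_filter (cof \<kappa>))"
    by eventually_elim (use b(2) in \<open>blast intro: less_trans\<close>)
  then show ?thesis using d(1) by blast
qed

section \<open>The club and goodness at its points\<close>

theorem theorem2p9:
  fixes \<kappa> \<kappa>p :: "'a::wellorder"
    and \<kappa>s :: "'a \<Rightarrow> 'a"
    and f :: "'a \<Rightarrow> 'a \<Rightarrow> 'a"
  assumes "singular_cardinal \<kappa>"
    and "is_card_succ \<kappa> \<kappa>p"
    and "is_scale \<kappa> \<kappa>p \<kappa>s f"
  shows "\<exists>C. club_in C \<kappa>p \<and>
    (\<forall>\<mu> \<nu> \<theta>. regular_cardinal \<mu> \<and> regular_cardinal \<nu> \<and> is_card_plus \<mu> (cof \<kappa>) \<theta> \<and>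
      cof \<kappa> < \<mu> \<and>
      osegment \<mu> <o cardSuc (cardSuc (cardSuc (osegment \<mu>))) \<and>
      cardSuc (cardSuc (cardSuc (osegment \<mu>))) \<le>o osegment \<nu> \<and>
      \<nu> < \<theta> \<and> \<theta> \<le> \<kappa> \<longrightarrow>
      (\<forall>\<alpha>\<in>C. cof \<alpha> = \<nu> \<longrightarrow> good_at \<kappa> \<kappa>s f \<alpha>))"
proof -
  define \<chi> where "\<chi> = cof \<kappa>"
  define F where "F = tail_filter \<chi>"
  have ic: "infinite_cardinal \<kappa>" using assms(1) unfolding singular_cardinal_def by blast
  have reg_\<chi>: "regular_cardinal \<chi>" unfolding \<chi>_def using regular_cof infinite_cardinal_is_limit[OF ic] by blast
  have lim_\<chi>: "is_limit \<chi>" using regular_is_limit[OF reg_\<chi>] .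
  have ne: "{..<\<chi>} \<noteq> {}" using lim_\<chi> unfolding is_limit_def by blast
  have sl: "scale_less \<kappa> p q \<longleftrightarrow> eventually (\<lambda>i. p i < q i) F" for p q
    using scale_less_iff reg_\<chi> unfolding \<chi>_def F_def by blast
  have A_ev: "eventually (\<lambda>a. a \<in> {..<\<chi>}) F" unfolding F_def eventually_tail[OF ne] using ne by blast
  have succ: "osegment \<kappa>p =o cardSuc (osegment \<kappa>)" using assms(2) unfolding is_card_succ_def .
  have reg_\<kappa>p: "regular_cardinal \<kappa>p"
    using ic regular_cardinal_cardSuc[OF _ _ succ] unfolding infinite_cardinal_def by blast
  have "osegment \<kappa> <o osegment \<kappa>p"
    using cardSuc_greater[of "osegment \<kappa>"] ic ordLess_ordIso_trans[OF _ ordIso_symmetric[OF succ]]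
    unfolding infinite_cardinal_def by blast
  then have \<kappa>\<kappa>p: "\<kappa> < \<kappa>p" using osegment_less_iff by blast
  have \<chi>\<kappa>p: "\<chi> < \<kappa>p" using \<kappa>\<kappa>p cof_singular_cardinal[OF assms(1)] unfolding \<chi>_def by simp
  have f_lt: "f \<alpha> a < \<kappa>s a" if "\<alpha> < \<kappa>p" "a < \<chi>" for \<alpha> a
    using assms(3) that unfolding is_scale_def scale_product_def \<chi>_def by (auto simp: Pi_iff)
  have f_inc: "eventually (\<lambda>a. f \<beta> a < f \<gamma> a) F" if "\<beta> < \<gamma>" "\<gamma> < \<kappa>p" for \<beta> \<gamma>
    using assms(3) that sl unfolding is_scale_def by blast
  \<comment> \<open>\<open>bd\<close> and \<open>D\<close> treat all \<open>\<delta>\<close> at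
    once, so the club does not depend on \<open>\<mu>\<close> and \<open>\<nu>\<close>.
    \<open>D \<delta>\<close> is below \<open>\<kappa>p\<close> even where no bound exists.\<close>
  define bd where "bd = (\<lambda>\<delta> d. d < \<kappa>p \<and> eventually (\<lambda>a. \<forall>i<cof \<delta>. f (cof_seq \<delta> i) a < f d a) F)"
  have "\<exists>d<\<kappa>p. (\<exists>d. bd \<delta> d) \<longrightarrow> bd \<delta> d" for \<delta> using \<kappa>\<kappa>p unfolding bd_def by blast
  then obtain D where D: "\<And>\<delta>. D \<delta> < \<kappa>p" "\<And>\<delta> d. bd \<delta> d \<Longrightarrow> bd \<delta> (D \<delta>)" by metis
  define C where "C = {\<rho>. \<rho> < \<kappa>p \<and> (\<forall>\<delta><\<rho>. D \<delta> < \<rho>)}"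
  have "club_in C \<kappa>p"
    unfolding C_def by (rule club_in_closure_points[OF reg_\<kappa>p reg_\<chi> \<chi>\<kappa>p]) (rule D(1))
  moreover have "good_at \<kappa> \<kappa>s f \<rho>"
    if \<mu>: "regular_cardinal \<mu>" and \<nu>: "regular_cardinal \<nu>" and plus: "is_card_plus \<mu> \<chi> \<theta>" and \<chi>\<mu>: "\<chi> < \<mu>"
      and s3: "cardSuc (cardSuc (cardSuc (osegment \<mu>))) \<le>o osegment \<nu>" and \<nu>\<theta>: "\<nu> < \<theta>" "\<theta> \<le> \<kappa>"
      and \<rho>: "\<rho> \<in> C" and cof_\<rho>: "cof \<rho> = \<nu>" for \<mu> \<nu> \<theta> \<rho>
  proof -
    have c0: "Cinfinite (osegment \<mu>)" using \<mu> unfolding regular_cardinal_def infinite_cardinal_def by blast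
    have c1: "Cinfinite (cardSuc (osegment \<mu>))" using Cinfinite_cardSuc[OF c0] .
    have c2: "Cinfinite (cardSuc (cardSuc (osegment \<mu>)))" using Cinfinite_cardSuc[OF c1] .
    \<comment> \<open>The two successors of \<open>\<mu>\<close> are ordinals of the type because
      they lie below \<open>\<nu>\<close>: \<open>\<mu>1\<close> is the first and
      \<open>\<Lambda>\<close> the second.\<close>
    have "cardSuc (cardSuc (osegment \<mu>)) <o osegment \<nu>"
      using cardSuc_greater c2 s3 ordLess_ordLeq_trans by blast
    then obtain \<Lambda> where \<Lambda>: "\<Lambda> < \<nu>" "cardSuc (cardSuc (osegment \<mu>)) =o osegment \<Lambda>"
      using ordLess_osegment_obtain[of "cardSuc (cardSuc (osegment \<mu>))" \<nu>] c2 card_order_on_well_order_on by blast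
    have "cardSuc (osegment \<mu>) <o osegment \<Lambda>"
      using cardSuc_greater c1 \<Lambda>(2) ordLess_ordIso_trans by blast
    then obtain \<mu>1 where \<mu>1: "\<mu>1 < \<Lambda>" "cardSuc (osegment \<mu>) =o osegment \<mu>1"
      using ordLess_osegment_obtain[of "cardSuc (osegment \<mu>)" \<Lambda>] c1 card_order_on_well_order_on by blast
    have "osegment \<mu> <o osegment \<mu>1" using cardSuc_greater c0 \<mu>1(2) ordLess_ordIso_trans by blast
    then have \<mu>\<mu>1: "\<mu> < \<mu>1" using osegment_less_iff by blast
    have reg_\<mu>1: "regular_cardinal \<mu>1" using regular_cardinal_cardSuc c0 ordIso_symmetric[OF \<mu>1(2)] by blast
    have reg_\<Lambda>: "regular_cardinal \<Lambda>" using regular_cardinal_cardSuc c1 ordIso_symmetric[OF \<Lambda>(2)] by blast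
    have \<rho>\<kappa>p: "\<rho> < \<kappa>p" and D_\<rho>: "\<And>\<delta>. \<delta> < \<rho> \<Longrightarrow> D \<delta> < \<rho>" using \<rho> unfolding C_def by blast+
    have A_small: "|{..<\<chi>}| <o osegment \<mu>" using card_lessThan_less[OF \<chi>\<mu>] .
    have inc: "eventually (\<lambda>a. f \<beta> a < f \<gamma> a) F" if "\<beta> < \<gamma>" "\<gamma> < \<rho>" for \<beta> \<gamma>
      using f_inc that \<rho>\<kappa>p by (meson less_trans)
    have bnd: "f \<beta> a < \<kappa>s a" if "a \<in> {..<\<chi>}" "\<beta> < \<rho>" for a \<beta> using f_lt that \<rho>\<kappa>p by (meson lessThan_iff less_trans)
    have \<Lambda>\<rho>: "\<Lambda> < cof \<rho>" using \<Lambda>(1) cof_\<rho> by simp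
    \<comment> \<open>The bound for \<open>\<delta>\<close> is \<open>D \<delta>\<close>, which is
      below \<open>\<rho>\<close> by closure.\<close>
    have bd\<rho>: "\<exists>d<\<rho>. eventually (\<lambda>a. \<forall>i<\<Lambda>. f (cof_seq \<delta> i) a < f d a) F" if \<delta>: "\<delta> < \<rho>" "cof \<delta> = \<Lambda>" for \<delta>
    proof -
      have "is_limit \<delta>" using is_limit_of_regular_le_cof[OF reg_\<Lambda>] \<delta>(2) by simp
      moreover have "\<delta> < \<kappa>p" using \<delta>(1) \<rho>\<kappa>p by (rule less_trans)
      moreover have "cof \<delta> < \<kappa>" using \<delta>(2) \<Lambda>(1) \<nu>\<theta> by simp
      ultimately have "\<exists>d. bd \<delta> d"
        using scale_bounds_short_sequences[OF assms(1,3)] reg_\<chi> unfolding bd_def F_def \<chi>_def by blast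
      then have "bd \<delta> (D \<delta>)" using D(2) by blast
      then show ?thesis using D_\<rho>[OF \<delta>(1)] \<delta>(2) unfolding bd_def by blast
    qed
    interpret rounding_sequence F "{..<\<chi>}" f \<kappa>s \<rho> \<mu>
    proof
      show "\<mu> < cof \<rho>" using \<mu>\<mu>1 \<mu>1(1) \<Lambda>\<rho> by simp
      fix S assume S: "\<And>a. a \<in> {..<\<chi>} \<Longrightarrow> |S a| <o osegment \<mu> \<and> \<kappa>s a \<in> S a"
      have S': "|S a| <o osegment \<mu>" "\<And>\<beta>. \<beta> < \<rho> \<Longrightarrow> \<exists>s\<in>S a. f \<beta> a \<le> s" if "a \<in> {..<\<chi>}" for a
        using S[OF that] bnd[OF that] less_imp_le by blast+
      show "\<exists>\<beta><\<rho>. \<forall>\<gamma><\<rho>. eventually (\<lambda>a. f \<gamma> a \<le> round_up S (f \<beta>) a) F"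
        by (rule bounding_projection[OF \<mu> reg_\<mu>1 reg_\<Lambda> \<mu>\<mu>1 \<mu>1(1) \<Lambda>\<rho> A_ev A_small])
          (use inc bd\<rho> S' in auto)
    qed (use \<mu> A_ev A_small inc bnd in auto)
    obtain g where g: "\<And>a. a \<in> {..<\<chi>} \<Longrightarrow> g a \<le> \<kappa>s a" "upper g" "\<And>u. upper u \<Longrightarrow> eventually (\<lambda>a. g a \<le> u a) F"
      using exists_lub by blast
    interpret least_bounded_sequence F "{..<\<chi>}" f \<kappa>s \<rho> \<mu> g
      by unfold_locales (use g in auto)
    define R where "R = {c. Card_order (osegment c) \<and> \<mu> \<le> c \<and> c < \<nu>}"
    have R_small: "|R| <o osegment \<chi>"
      unfolding R_def by (rule few_cardinals_between[OF plus _ lim_\<chi> \<nu>\<theta>(1)]) (use c0 in blast)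
    \<comment> \<open>Each \<open>c\<close> in \<open>R\<close> is excluded as a cofinality from
      some index on. Since \<open>R\<close> has fewer than \<open>\<chi>\<close> elements, one index
      \<open>j1\<close> serves for all.\<close>
    have "\<exists>j. c \<in> R \<longrightarrow> j < \<chi> \<and> (\<forall>a. j \<le> a \<and> a < \<chi> \<longrightarrow> cof (g a) \<noteq> c)" for c
      using cof_lub_neq[of c] cof_\<rho> unfolding R_def F_def eventually_tail[OF ne] by blast
    then obtain j where j: "\<And>c. c \<in> R \<Longrightarrow> j c < \<chi>" "\<And>c a. c \<in> R \<Longrightarrow> j c \<le> a \<Longrightarrow> a < \<chi> \<Longrightarrow> cof (g a) \<noteq> c" by metis
    have "|j ` R| <o osegment \<chi>" using card_of_image R_small ordLeq_ordLess_trans by blast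
    then have "\<exists>b<\<chi>. \<forall>y\<in>j ` R. y < b" by (rule regular_small_bounded[OF reg_\<chi>]) (use j(1) in auto)
    then obtain j1 where j1: "j1 < \<chi>" "\<And>c. c \<in> R \<Longrightarrow> j c < j1" by blast
    have "cof (g a) \<notin> R" if "j1 \<le> a" "a < \<chi>" for a
    proof
      assume r: "cof (g a) \<in> R"
      have "j (cof (g a)) \<le> a" using j1(2)[OF r] that(1) by simp
      then show False using j(2)[OF r _ that(2)] by blast
    qed
    then have "eventually (\<lambda>a. cof (g a) \<notin> R) F" unfolding F_def eventually_tail[OF ne] using j1(1) by blast
    \<comment> \<open>Cofinalities are cardinals; between \<open>\<mu>\<close> and
      \<open>\<nu>\<close> and outside \<open>R\<close>, only \<open>\<nu>\<close> is left.\<close>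
    with le_cof_lub cof_lub_le have "eventually (\<lambda>a. cof (g a) = \<nu>) F"
    proof eventually_elim
      case (elim a)
      then show ?case using Card_order_cof[of "g a"] cof_\<rho> unfolding R_def by auto
    qed
    then obtain j0 where j0: "j0 < \<chi>" "\<And>a. j0 \<le> a \<Longrightarrow> a < \<chi> \<Longrightarrow> cof (g a) = \<nu>"
      unfolding F_def eventually_tail[OF ne] by blast
    have lim_g: "is_limit (g a)" if "j0 \<le> a" "a < \<chi>" for a
      using is_limit_of_regular_le_cof[OF \<nu>] j0(2)[OF that] by simp
    have J_ev: "eventually (\<lambda>a. j0 \<le> a \<and> a < \<chi>) F" unfolding F_def eventually_tail[OF ne] using j0(1) by blast
    obtain \<beta>0 where \<beta>0: "\<beta>0 < \<rho>" using limit unfolding is_limit_def by blast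
    \<comment> \<open>The goodness witnesses run along cofinal sequences of the \<open>g a\<close>.
      Before \<open>j0\<close> the value of \<open>f \<beta>0\<close> keeps them in the
      product.\<close>
    define G where "G = (\<lambda>i a. if j0 \<le> a \<and> a < \<chi> then cof_seq (g a) i else f \<beta>0 a)"
    have G_lt: "G i a < g a" if "i < \<nu>" "j0 \<le> a" "a < \<chi>" for i a
      using cof_seq_less[OF lim_g[OF that(2,3)]] j0(2)[OF that(2,3)] that unfolding G_def by simp
    show "good_at \<kappa> \<kappa>s f \<rho>"
      unfolding good_at_def cof_\<rho> \<chi>_def[symmetric]
    proof (rule exI[of _ G], rule exI[of _ j0], intro conjI allI impI)
      show "j0 < \<chi>" by (rule j0(1))
    next
      fix i assume i: "i < \<nu>"
      show "G i \<in> scale_product \<kappa> \<kappa>s"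
        unfolding scale_product_def \<chi>_def[symmetric]
      proof
        fix a assume a: "a \<in> {..<\<chi>}"
        show "G i a \<in> {..<\<kappa>s a}"
        proof (cases "j0 \<le> a")
          case True
          then show ?thesis using G_lt[OF i True] g(1)[OF a] a by (auto intro: less_le_trans)
        next
          case False
          then show ?thesis using bnd[OF a \<beta>0] unfolding G_def by simp
        qed
      qed
    next
      fix a assume "j0 \<le> a \<and> a < \<chi>"
      then have a: "j0 \<le> a" "a < \<chi>" by blast+
      have "strict_mono_on {..<\<nu>} (cof_seq (g a))"
        using cof_seq_normal[OF lim_g[OF a]] j0(2)[OF a] unfolding normal_on_def by simp
      then show "strict_mono_on {..<\<nu>} (\<lambda>i. G i a)" unfolding G_def using a by simp
    next
      fix i assume i: "i < \<nu>"
      have "eventually (\<lambda>a. G i a < g a) F" by (rule eventually_mono[OF J_ev]) (use G_lt[OF i] in blast)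
      from exact[OF this] obtain \<beta> where "\<beta> < \<rho>" "eventually (\<lambda>a. G i a < f \<beta> a) F" by blast
      then show "\<exists>\<beta><\<rho>. scale_less \<kappa> (G i) (f \<beta>)" using sl by blast
    next
      fix \<beta> assume \<beta>: "\<beta> < \<rho>"
      have "\<exists>k. k < \<nu> \<and> (j0 \<le> a \<longrightarrow> a < \<chi> \<longrightarrow> f \<beta> a < g a \<longrightarrow> f \<beta> a < cof_seq (g a) k)" for a
        using cof_seq_cofinal[OF lim_g, of a "f \<beta> a"] j0(2)[of a] \<Lambda>(1) by blast
      then obtain k where k: "\<And>a. k a < \<nu>"
        "\<And>a. j0 \<le> a \<Longrightarrow> a < \<chi> \<Longrightarrow> f \<beta> a < g a \<Longrightarrow> f \<beta> a < cof_seq (g a) (k a)" by metis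
      \<comment> \<open>Each coordinate needs its own index \<open>k a < \<nu>\<close>; since
        \<open>\<chi> < \<nu>\<close> and \<open>\<nu>\<close> is regular, one
        \<open>c < \<nu>\<close> exceeds them all.\<close>
      have "\<chi> < cof \<nu>" using \<chi>\<mu> \<mu>\<mu>1 \<mu>1(1) \<Lambda>(1) cof_regular_cardinal[OF \<nu>] by simp
      from cof_less_of_small_bound[where h = k, OF this k(1)] obtain c where c: "c < \<nu>" "\<And>a. a < \<chi> \<Longrightarrow> k a < c" by blast
      from J_ev less_lub[OF \<beta>] have "eventually (\<lambda>a. f \<beta> a < G c a) F"
      proof eventually_elim
        case (elim a)
        have a: "j0 \<le> a" "a < \<chi>" using elim by blast+
        have "cof_seq (g a) (k a) < cof_seq (g a) c"
          using normal_on_less[OF cof_seq_normal[OF lim_g[OF a]] c(2)[OF a(2)]] c(1) j0(2)[OF a] by simp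
        then show ?case using k(2)[OF a elim(2)] a unfolding G_def by (simp add: less_trans)
      qed
      then show "\<exists>i<\<nu>. scale_less \<kappa> (f \<beta>) (G i)" using c(1) sl by blast
    qed
  qed
  ultimately show ?thesis unfolding \<chi>_def by (intro exI[of _ C]) blast
qed

end
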